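(* Let $p_i=1/m$ and $n_i=n$ for all $i\in[m]$, put $N=mn$ and $\kappa=L/\mu$. Suppose the smoothness, strong convexity, and bounded-gradient-variance assumptions (A1), (A2), (A3) hold, and that $\{\boldsymbol{w}_\star^{(i)}\}_{i=1}^m\in\mathcal{P}(R)$. Let $\lambda>0$ be chosen such that $$\lambda\ \ge\ \max\Big\{64\kappa^2L,\ (2\kappa\vee5)\,\mu\,\frac{2L^2R^2+\rho^2/n}{L^2R^2+\rho^2/N}\Big\}-\mu\quad\text{when } R\le\frac1{\sqrt n},$$ $$\lambda\ \le\ \frac{\rho^2}{n\mu R^2}\quad\text{when } R>\frac1{\sqrt n}.$$ Then for all $i\in[m]$ the local model $\widetilde{\boldsymbol{w}}^{(i)}$ obtained by solving Problem (P) satisfies $$\mathbb{E}\big\|\widetilde{\boldsymbol{w}}^{(i)}-\boldsymbol{w}_\star^{(i)}\big\|^2\le C_3\frac1N+C_4\Big(R^2\wedge\frac1n\Big),$$ where $$C_3=\frac{192\rho^2}{\mu^2},\qquad C_4=\Big(\frac{\rho\,(1+(4C_2+5)^{1/2})}{\mu}\Big)^2\vee198\kappa^2,\qquad C_2=\Big(\frac{(1+\sqrt3)\rho}{\mu}\Big)^2\vee\frac{32L^2}{\mu^2}.$$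
   Context: $a\wedge b=\min\{a,b\}$, $a\vee b=\max\{a,b\}$. Setting. There are $m$ clients; client $i\in[m]=\{1,\dots,m\}$ has data $S_i=\{z_{ij}\}_{j\in[n_i]}$ drawn i.i.d. from a distribution $\mathcal{D}_i$ (the $\mathcal D_i$ may differ), with data of different clients independent. $\ell(\boldsymbol{w},z)$ is a loss function, differentiable in $\boldsymbol{w}\in\mathbb{R}^d$; $\nabla\ell$ is the gradient in $\boldsymbol{w}$. $L_i(\boldsymbol{w},S_i)=\frac1{n_i}\sum_{j=1}^{n_i}\ell(\boldsymbol{w},z_{ij})$. The ground truth model of client $i$ is $\boldsymbol{w}_\star^{(i)}\in\arg\min_{\boldsymbol{w}}\mathbb{E}_{z\sim\mathcal{D}_i}\ell(\boldsymbol{w},z)$. $\|\cdot\|$ is the Euclidean norm; $\mathbb{E}$ is over the joint distribution of all data. Problem (P): with weights $p_i$, $\sum_i p_i=1$, and $\lambda>0$, $\big(\widetilde{\boldsymbol{w}}^{(g)},\{\widetilde{\boldsymbol{w}}^{(i)}\}_{i=1}^m\big)$ is the minimizer of $$\min_{\boldsymbol{w}^{(g)},\{\boldsymbol{w}^{(i)}\}}\ \sum_{i\in[m]}p_i\Big(L_i(\boldsymbol{w}^{(i)},S_i)+\frac{\lambda}{2}\|\boldsymbol{w}^{(g)}-\boldsymbol{w}^{(i)}\|^2\Big).$$ Parameter space: $\mathcal{P}(R)=\big\{\{\boldsymbol{w}_\star^{(i)}\}_{i=1}^m:\ \|\boldsymbol{w}_\star^{(i)}-\sum_{k=1}^m p_k\boldsymbol{w}_\star^{(k)}\|^2\le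 R^2\ \forall i\in[m]\big\}$. Assumptions. (A1) $\|\nabla\ell(x,z)-\nabla\ell(y,z)\|\le L\|x-y\|$ for all $x,y\in\mathbb{R}^d$ and all $z$. (A2) Each $L_i(\cdot,S_i)$ is $\mu$-strongly convex ($\mu>0$): $L_i(x,S_i)\ge L_i(y,S_i)+\langle\nabla L_i(y,S_i),x-y\rangle+\frac{\mu}{2}\|x-y\|^2$ for all $x,y$. (A3) There is a constant $\rho\ge0$ with $\mathbb{E}_{z\sim\mathcal{D}_i}\|\nabla\ell(\boldsymbol{w}_\star^{(i)},z)\|^2\le\rho^2$ for all $i\in[m]$. *)

theory Defs
  imports "HOL-Probability.Probability"
begin

definition grad :: "('v::real_inner \<Rightarrow> real) \<Rightarrow> 'v \<Rightarrow> 'v" where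
  "grad f x = (THE D. GDERIV f x :> D)"

text \<open>Clients are indexed by \<open>{1..m}\<close>, and the data points of client \<open>i\<close> by \<open>{1..n i}\<close>.
  A data set is a function on the index set; its values at other indices are irrelevant.\<close>

definition client_data ::
    "'w measure \<Rightarrow> 'z measure \<Rightarrow> (nat \<Rightarrow> 'z measure) \<Rightarrow> nat \<Rightarrow> (nat \<Rightarrow> nat) \<Rightarrow>
      (nat \<Rightarrow> nat \<Rightarrow> 'w \<Rightarrow> 'z) \<Rightarrow> bool" where
  "client_data M Zs D m n Z \<longleftrightarrow>
     prob_space M \<and>
     prob_space.indep_vars M (\<lambda>_. Zs) (\<lambda>(i, j). Z i j) (SIGMA i:{1..m}. {1..n i}) \<and>
     (\<forall>i\<in>{1..m}. \<forall>j\<in>{1..n i}. distr M Zs (Z i j) = D i)"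

definition emp_loss :: "('v \<Rightarrow> 'z \<Rightarrow> real) \<Rightarrow> nat \<Rightarrow> (nat \<Rightarrow> 'z) \<Rightarrow> 'v \<Rightarrow> real" where
  "emp_loss loss n S w = (1 / real n) * (\<Sum>j=1..n. loss w (S j))"

text \<open>The Bochner integral of a non-integrable function is 0, so integrability is required
  explicitly for the population risk to be meaningful.\<close>

definition ground_truth :: "('v \<Rightarrow> 'z \<Rightarrow> real) \<Rightarrow> 'z measure \<Rightarrow> 'v \<Rightarrow> bool" where
  "ground_truth loss D w \<longleftrightarrow>
     (\<forall>v. integrable D (loss v)) \<and>
     is_arg_min (\<lambda>v. \<integral>z. loss v z \<partial>D) (\<lambda>_. True) w"

definition fed_objective ::
    "('v::real_inner \<Rightarrow> 'z \<Rightarrow> real) \<Rightarrow> nat \<Rightarrow> (nat \<Rightarrow> real) \<Rightarrow> (nat \<Rightarrow> nat) \<Rightarrow> real \<Rightarrow>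
      (nat \<Rightarrow> nat \<Rightarrow> 'z) \<Rightarrow> 'v \<times> (nat \<Rightarrow> 'v) \<Rightarrow> real" where
  "fed_objective loss m p n lam S = (\<lambda>(wg, wl).
     \<Sum>i=1..m. p i * (emp_loss loss (n i) (S i) (wl i) + lam / 2 * (norm (wg - wl i))\<^sup>2))"

text \<open>Local models with index outside \<open>{1..m}\<close> do not enter the objective and are unconstrained.\<close>

definition fed_solution ::
    "('v::real_inner \<Rightarrow> 'z \<Rightarrow> real) \<Rightarrow> nat \<Rightarrow> (nat \<Rightarrow> real) \<Rightarrow> (nat \<Rightarrow> nat) \<Rightarrow> real \<Rightarrow>
      (nat \<Rightarrow> nat \<Rightarrow> 'z) \<Rightarrow> 'v \<Rightarrow> (nat \<Rightarrow> 'v) \<Rightarrow> bool" where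
  "fed_solution loss m p n lam S wg wl \<longleftrightarrow>
     is_arg_min (fed_objective loss m p n lam S) (\<lambda>_. True) (wg, wl)"

definition param_space ::
    "nat \<Rightarrow> (nat \<Rightarrow> real) \<Rightarrow> real \<Rightarrow> (nat \<Rightarrow> 'v::real_normed_vector) set" where
  "param_space m p R =
     {w. \<forall>i\<in>{1..m}. (norm (w i - (\<Sum>k=1..m. p k *\<^sub>R w k)))\<^sup>2 \<le> R\<^sup>2}"

definition strongly_convex :: "real \<Rightarrow> ('v::real_inner \<Rightarrow> real) \<Rightarrow> bool" where
  "strongly_convex \<mu> f \<longleftrightarrow>
     (\<forall>x y. f x \<ge> f y + grad f y \<bullet> (x - y) + \<mu> / 2 * (norm (x - y))\<^sup>2)"

end

theory Submission
  imports Defs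
begin

text \<open>
  Everything reduces to bounds that hold for each data set. Let \<open>g\<^sub>i\<close> be the gradient of
  \<open>L\<^sub>i\<close> at the ground truth of client \<open>i\<close>; as a mean of i.i.d. centred vectors it has second
  moment at most \<open>\<rho>\<^sup>2 / n\<close>, and the mean of all \<open>g\<^sub>i\<close> has second moment at most \<open>\<rho>\<^sup>2 / N\<close>.

  If \<open>R > 1 / \<surd>n\<close>, testing strong monotonicity of the gradients against the errors, the coupling
  term costs at most \<open>\<lambda>R\<^sup>2 / 4\<close> on average, because the deviations from the global model sum to
  zero. This bounds the average error, hence that of the global model, and a second application of
  the same estimate bounds each local error.

  If \<open>R \<le> 1 / \<surd>n\<close>, the local models are within \<open>O(1 / (\<lambda> + \<mu>))\<close> of the global one. As their
  gradients sum to zero, the average gradient is small at the global model, whose error is therefore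
  controlled by the mean of all \<open>g\<^sub>i\<close>, by \<open>L R\<close>, and by \<open>L / (\<lambda> + \<mu>)\<close> times the individual noise; the
  lower bound on \<open>\<lambda>\<close> absorbs the latter.
\<close>

subsection \<open>Gradients and optimality conditions\<close>

text \<open>Derivatives are unique and the inner product separates vectors, so the definite
  description in \<open>grad\<close> is settled by any gradient that can be exhibited.\<close>

lemma grad_eqI:
  fixes f :: "'v::real_inner \<Rightarrow> real"
  assumes "GDERIV f x :> d"
  shows "grad f x = d"
proof -
  have "e = d" if "GDERIV f x :> e" for e
  proof -
    have "(\<lambda>h. h \<bullet> e) = (\<lambda>h. h \<bullet> d)"
      using that assms unfolding gderiv_def by (rule has_derivative_unique)
    then show ?thesis by (metis vector_eq_ldot)
  qed
  with assms show ?thesis unfolding grad_def by blast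
qed

text \<open>Riesz representation in finite dimension: the values of the derivative on the basis
  vectors are the coordinates of the gradient.\<close>

lemma GDERIV_grad:
  fixes f :: "'v::euclidean_space \<Rightarrow> real"
  assumes "f differentiable (at x)"
  shows "GDERIV f x :> grad f x"
proof -
  obtain f' where f': "(f has_derivative f') (at x)"
    using assms by (auto simp: differentiable_def)
  then have lin: "linear f'" by (intro bounded_linear.linear has_derivative_bounded_linear)
  define d where "d = (\<Sum>b\<in>Basis. f' b *\<^sub>R b)"
  have "f' h = h \<bullet> d" for h
  proof -
    have "f' h = f' (\<Sum>b\<in>Basis. (h \<bullet> b) *\<^sub>R b)" by (simp only: euclidean_representation)
    also have "\<dots> = (\<Sum>b\<in>Basis. (h \<bullet> b) * f' b)"
      by (simp only: linear_sum[OF lin] linear_cmul[OF lin] real_scaleR_def)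
    finally show ?thesis by (simp add: d_def inner_sum_right mult.commute)
  qed
  then have "f' = (\<lambda>h. h \<bullet> d)" by (rule ext)
  with f' have "GDERIV f x :> d" by (simp add: gderiv_def)
  then show ?thesis by (simp add: grad_eqI)
qed

lemma GDERIV_half_sq_dist:
  fixes a :: "'v::real_inner"
  shows "GDERIV (\<lambda>v. c / 2 * (norm (a - v))\<^sup>2) x :> c *\<^sub>R (x - a)"
  unfolding gderiv_def power2_norm_eq_inner
  by (auto intro!: derivative_eq_intros simp: inner_commute algebra_simps)

lemma GDERIV_zero_minimum:
  fixes f :: "'v::real_inner \<Rightarrow> real"
  assumes "GDERIV f x :> d" "\<And>y. f x \<le> f y"
  shows "d = 0"
proof -
  have "(\<lambda>h. h \<bullet> d) = (\<lambda>h. 0)"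
    using differential_zero_maxmin[of x UNIV f "\<lambda>h. h \<bullet> d"] assms
    by (auto simp: gderiv_def)
  then show ?thesis by (metis inner_eq_zero_iff)
qed

lemma GDERIV_emp_loss:
  fixes loss :: "'v::euclidean_space \<Rightarrow> 'z \<Rightarrow> real"
  assumes "\<And>j. j \<in> {1..n} \<Longrightarrow> (\<lambda>v. loss v (S j)) differentiable (at w)"
  shows "GDERIV (emp_loss loss n S) w :>
    (1 / real n) *\<^sub>R (\<Sum>j=1..n. grad (\<lambda>v. loss v (S j)) w)"
proof -
  have "GDERIV (\<lambda>v. loss v (S j)) w :> grad (\<lambda>v. loss v (S j)) w" if "j \<in> {1..n}" for j
    using GDERIV_grad assms that by blast
  then have "((\<lambda>v. 1 / real n * (\<Sum>j=1..n. loss v (S j))) has_derivative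
      (\<lambda>h. 1 / real n * (\<Sum>j=1..n. h \<bullet> grad (\<lambda>v. loss v (S j)) w))) (at w)"
    unfolding gderiv_def by (intro has_derivative_mult_right has_derivative_sum) auto
  then show ?thesis
    unfolding gderiv_def emp_loss_def[abs_def] by (simp add: inner_sum_right)
qed

text \<open>Adding the strong convexity inequality to itself with \<open>x\<close> and
  \<open>y\<close> exchanged cancels the function values and joins the two halves of \<mu>.\<close>

lemma strongly_convex_monotone:
  assumes "strongly_convex \<mu> f"
  shows "(grad f x - grad f y) \<bullet> (x - y) \<ge> \<mu> * (norm (x - y))\<^sup>2"
proof -
  have "f x \<ge> f y + grad f y \<bullet> (x - y) + \<mu> / 2 * (norm (x - y))\<^sup>2"
    "f y \<ge> f x + grad f x \<bullet> (y - x) + \<mu> / 2 * (norm (x - y))\<^sup>2"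
    using assms unfolding strongly_convex_def by (blast, simp only: norm_minus_commute[of x])
  moreover have "grad f x \<bullet> (y - x) = - (grad f x \<bullet> (x - y))"
    by (simp add: inner_diff_right)
  ultimately show ?thesis by (simp add: inner_diff_left field_simps)
qed

section \<open>First-order conditions of Problem (P) and quadratic growth of its objective\<close>

lemma fed_solution_local_stationary:
  fixes wg :: "'v::real_inner"
  assumes sol: "fed_solution loss m p n lam S wg wl"
    and i: "i \<in> {1..m}" "p i > 0"
    and d: "GDERIV (emp_loss loss (n i) (S i)) (wl i) :> d"
  shows "d = lam *\<^sub>R (wg - wl i)"
proof -
  let ?f = "\<lambda>v. emp_loss loss (n i) (S i) v + lam / 2 * (norm (wg - v))\<^sup>2"
  have "?f (wl i) \<le> ?f v" for v
  proof -
    \<comment> \<open>Only the local model of client \<open>i\<close> is perturbed. All other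
      summands cancel and the positive weight \<open>p i\<close> divides out.\<close>
    have "fed_objective loss m p n lam S (wg, wl) \<le> fed_objective loss m p n lam S (wg, wl(i := v))"
      using sol by (auto simp: fed_solution_def is_arg_min_linorder)
    moreover have "fed_objective loss m p n lam S (wg, u) = p i * ?f (u i) +
        (\<Sum>k\<in>{1..m} - {i}. p k * (emp_loss loss (n k) (S k) (u k) + lam / 2 * (norm (wg - u k))\<^sup>2))"
      for u
      unfolding fed_objective_def prod.case using i by (intro sum.remove) auto
    moreover have "(\<Sum>k\<in>{1..m} - {i}. p k * (emp_loss loss (n k) (S k) ((wl(i := v)) k)
          + lam / 2 * (norm (wg - (wl(i := v)) k))\<^sup>2))
        = (\<Sum>k\<in>{1..m} - {i}. p k * (emp_loss loss (n k) (S k) (wl k) + lam / 2 * (norm (wg - wl k))\<^sup>2))"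
      by (intro sum.cong) auto
    ultimately have "p i * ?f (wl i) \<le> p i * ?f v" by simp
    then show ?thesis using i by simp
  qed
  moreover have "GDERIV ?f (wl i) :> d + lam *\<^sub>R (wl i - wg)"
    by (intro GDERIV_add d GDERIV_half_sq_dist)
  ultimately have "d + lam *\<^sub>R (wl i - wg) = 0" by (intro GDERIV_zero_minimum)
  then have "d = - (lam *\<^sub>R (wl i - wg))" by (simp only: eq_neg_iff_add_eq_0)
  then show ?thesis by (simp add: scaleR_diff_right)
qed

text \<open>With the local models frozen, the objective is a weighted sum of squared distances in
  the global model, up to a constant. At its minimum the weighted deviations balance.\<close>

lemma fed_solution_global_stationary:
  fixes wg :: "'v::real_inner"
  assumes sol: "fed_solution loss m p n lam S wg wl" and "lam \<noteq> 0"
  shows "(\<Sum>i=1..m. p i *\<^sub>R (wg - wl i)) = 0"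
proof -
  let ?f = "\<lambda>v. \<Sum>i=1..m. p i * (emp_loss loss (n i) (S i) (wl i) + lam / 2 * (norm (v - wl i))\<^sup>2)"
  have "?f wg \<le> ?f v" for v
    using sol by (auto simp: fed_solution_def is_arg_min_linorder fed_objective_def)
  moreover have "GDERIV ?f wg :> (\<Sum>i=1..m. p i *\<^sub>R (lam *\<^sub>R (wg - wl i)))"
    unfolding gderiv_def power2_norm_eq_inner
    by (auto intro!: derivative_eq_intros sum.cong simp: inner_sum_right inner_commute algebra_simps)
  ultimately have "(\<Sum>i=1..m. p i *\<^sub>R (lam *\<^sub>R (wg - wl i))) = 0" by (intro GDERIV_zero_minimum)
  then have "lam *\<^sub>R (\<Sum>i=1..m. p i *\<^sub>R (wg - wl i)) = 0"
    by (simp add: scaleR_right.sum mult.commute)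
  with assms show ?thesis by simp
qed

text \<open>A stationary point minimizes the objective with a quadratic margin in the local models.
  This margin is what turns near-minimizers into good approximations in the measurability
  argument.\<close>

lemma fed_objective_quadratic_growth:
  fixes wg :: "'v::real_inner"
  assumes p: "\<And>i. i \<in> {1..m} \<Longrightarrow> p i \<ge> 0" and lam: "lam \<ge> 0"
    and convex: "\<And>i. i \<in> {1..m} \<Longrightarrow> strongly_convex \<mu> (emp_loss loss (n i) (S i))"
    and stationary: "\<And>i. i \<in> {1..m} \<Longrightarrow>
      grad (emp_loss loss (n i) (S i)) (wl i) = lam *\<^sub>R (wg - wl i)"
    and center: "(\<Sum>i=1..m. p i *\<^sub>R (wg - wl i)) = 0"
  shows "fed_objective loss m p n lam S (v, u) \<ge>
    fed_objective loss m p n lam S (wg, wl) + (\<Sum>i=1..m. p i * (\<mu> / 2 * (norm (u i - wl i))\<^sup>2))"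
proof -
  let ?f = "\<lambda>i. emp_loss loss (n i) (S i)"
  have "?f i (u i) + lam / 2 * (norm (v - u i))\<^sup>2 \<ge>
      ?f i (wl i) + lam / 2 * (norm (wg - wl i))\<^sup>2
      + lam * ((wg - wl i) \<bullet> (v - wg)) + \<mu> / 2 * (norm (u i - wl i))\<^sup>2"
    if i: "i \<in> {1..m}" for i
  proof -
    have 1: "?f i (u i) \<ge> ?f i (wl i) + lam * ((wg - wl i) \<bullet> (u i - wl i))
        + \<mu> / 2 * (norm (u i - wl i))\<^sup>2"
      using convex[OF i, unfolded strongly_convex_def, rule_format, of "wl i" "u i"]
      by (simp only: stationary[OF i] inner_scaleR_left)
    \<comment> \<open>Expansion of the square around \<open>wg - wl i\<close>. After multiplication
      by \<open>lam / 2\<close>, its inner product with \<open>u i - wl i\<close> cancels the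
      gradient term of the strong convexity bound.\<close>
    have "(norm (v - u i))\<^sup>2 = (norm (wg - wl i))\<^sup>2
        + 2 * ((wg - wl i) \<bullet> (v - wg)) - 2 * ((wg - wl i) \<bullet> (u i - wl i))
        + (norm ((v - u i) - (wg - wl i)))\<^sup>2"
      by (simp add: power2_norm_eq_inner inner_diff_left inner_diff_right inner_commute)
    then have "(norm (v - u i))\<^sup>2 \<ge> (norm (wg - wl i))\<^sup>2
        + 2 * ((wg - wl i) \<bullet> (v - wg)) - 2 * ((wg - wl i) \<bullet> (u i - wl i))"
      by simp
    then have "lam / 2 * (norm (v - u i))\<^sup>2 \<ge> lam / 2 * ((norm (wg - wl i))\<^sup>2
        + 2 * ((wg - wl i) \<bullet> (v - wg)) - 2 * ((wg - wl i) \<bullet> (u i - wl i)))"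
      using lam by (intro mult_left_mono) auto
    with 1 show ?thesis by (simp add: algebra_simps)
  qed
  then have "(\<Sum>i=1..m. p i * (?f i (u i) + lam / 2 * (norm (v - u i))\<^sup>2)) \<ge>
     (\<Sum>i=1..m. p i * (?f i (wl i) + lam / 2 * (norm (wg - wl i))\<^sup>2
      + lam * ((wg - wl i) \<bullet> (v - wg)) + \<mu> / 2 * (norm (u i - wl i))\<^sup>2))"
    using p by (intro sum_mono mult_left_mono) auto
  \<comment> \<open>The remaining linear terms all pair with the same vector \<open>v - wg\<close>,
    so balance of the deviations removes them.\<close>
  moreover have "(\<Sum>i=1..m. p i * (lam * ((wg - wl i) \<bullet> (v - wg)))) = 0"
  proof -
    have "(\<Sum>i=1..m. p i * (lam * ((wg - wl i) \<bullet> (v - wg))))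
        = lam * ((\<Sum>i=1..m. p i *\<^sub>R (wg - wl i)) \<bullet> (v - wg))"
      by (simp add: inner_sum_left sum_distrib_left ac_simps)
    with center show ?thesis by simp
  qed
  ultimately show ?thesis
    unfolding fed_objective_def by (simp add: distrib_left sum.distrib)
qed

section \<open>Lipschitz gradients and elementary norm inequalities\<close>

lemma grad_emp_loss_lipschitz:
  fixes loss :: "'v::euclidean_space \<Rightarrow> 'z \<Rightarrow> real"
  assumes n: "n \<ge> 1"
    and diff: "\<And>j w. j \<in> {1..n} \<Longrightarrow> (\<lambda>v. loss v (S j)) differentiable (at w)"
    and lip: "\<And>j x y. j \<in> {1..n} \<Longrightarrow>
      norm (grad (\<lambda>v. loss v (S j)) x - grad (\<lambda>v. loss v (S j)) y) \<le> L * norm (x - y)"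
  shows "norm (grad (emp_loss loss n S) x - grad (emp_loss loss n S) y) \<le> L * norm (x - y)"
proof -
  let ?g = "\<lambda>w j. grad (\<lambda>v. loss v (S j)) w"
  have g: "grad (emp_loss loss n S) w = (1 / real n) *\<^sub>R (\<Sum>j=1..n. ?g w j)" for w
    using diff by (intro grad_eqI GDERIV_emp_loss) auto
  have "grad (emp_loss loss n S) x - grad (emp_loss loss n S) y = (1 / real n) *\<^sub>R (\<Sum>j=1..n. ?g x j - ?g y j)"
    unfolding g by (simp only: sum_subtractf scaleR_right_diff_distrib)
  then have "norm (grad (emp_loss loss n S) x - grad (emp_loss loss n S) y)
      = norm (\<Sum>j=1..n. ?g x j - ?g y j) / real n" by simp
  also have "\<dots> \<le> (\<Sum>j=1..n. L * norm (x - y)) / real n"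
    using lip by (intro divide_right_mono sum_norm_le) auto
  also have "\<dots> = L * norm (x - y)" using n by simp
  finally show ?thesis .
qed

text \<open>Both conditions are tested at the origin and a unit vector, which exists because a
  euclidean space has positive dimension. The result makes the condition number at least 1.\<close>

lemma monotone_lipschitz_constants_le:
  fixes G :: "'v::euclidean_space \<Rightarrow> 'v"
  assumes mono: "\<And>x y. (G x - G y) \<bullet> (x - y) \<ge> \<mu> * (norm (x - y))\<^sup>2"
    and lip: "\<And>x y. norm (G x - G y) \<le> L * norm (x - y)"
  shows "\<mu> \<le> L"
proof -
  obtain b :: 'v where b: "b \<in> Basis" by (meson nonempty_Basis all_not_in_conv)
  have "\<mu> \<le> (G b - G 0) \<bullet> (b - 0)" using mono[of b 0] b by simp
  also have "\<dots> \<le> norm (G b - G 0) * norm (b - 0)" by (rule norm_cauchy_schwarz)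
  also have "\<dots> \<le> L" using lip[of b 0] b by simp
  finally show ?thesis .
qed

lemma norm_sum_squared_le:
  fixes x :: "'i \<Rightarrow> 'v::real_normed_vector"
  shows "(norm (\<Sum>i\<in>I. x i))\<^sup>2 \<le> real (card I) * (\<Sum>i\<in>I. (norm (x i))\<^sup>2)"
proof -
  have "(norm (\<Sum>i\<in>I. x i))\<^sup>2 \<le> (\<Sum>i\<in>I. norm (x i))\<^sup>2"
    by (intro power_mono norm_sum) auto
  also have "\<dots> \<le> (\<Sum>i\<in>I. (norm (x i))\<^sup>2) * card I"
    by (rule sum_squared_le_sum_of_squares)
  finally show ?thesis by (simp add: mult.commute)
qed

text \<open>Completing the square. Applied to a deviation \<open>u\<close> from the global model, it
  bounds from below what the coupling can contribute; the factor 1/4 in the weak coupling bounds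
  originates here.\<close>

lemma inner_add_self_ge:
  fixes u v :: "'v::real_inner"
  shows "u \<bullet> (u + v) \<ge> - (norm v)\<^sup>2 / 4"
proof -
  have "0 \<le> (norm (u + (1/2) *\<^sub>R v))\<^sup>2" by simp
  also have "\<dots> = u \<bullet> (u + v) + (norm v)\<^sup>2 / 4"
    by (simp add: power2_norm_eq_inner inner_simps inner_commute field_simps)
  finally show ?thesis by simp
qed

text \<open>Young's inequality; the weight \<open>c\<close> lets half of a strong convexity term
  absorb the product.\<close>

lemma mult_le_weighted_squares:
  fixes a b c :: real
  assumes "c > 0"
  shows "a * b \<le> a\<^sup>2 / (2 * c) + c / 2 * b\<^sup>2"
proof -
  have "0 \<le> (a - c * b)\<^sup>2 / (2 * c)" using assms by simp
  also have "\<dots> = a\<^sup>2 / (2 * c) + c / 2 * b\<^sup>2 - a * b"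
    using assms by (simp add: power2_eq_square field_simps)
  finally show ?thesis by simp
qed

lemma norm_add_squared_le:
  fixes x y :: "'v::real_normed_vector"
  shows "(norm (x + y))\<^sup>2 \<le> 2 * (norm x)\<^sup>2 + 2 * (norm y)\<^sup>2"
proof -
  have "(norm (x + y))\<^sup>2 \<le> (norm x + norm y)\<^sup>2" by (intro power_mono norm_triangle_ineq) auto
  also have "\<dots> \<le> 2 * (norm x)\<^sup>2 + 2 * (norm y)\<^sup>2"
    using sum_squares_bound[of "norm x" "norm y"] by (simp add: power2_sum)
  finally show ?thesis .
qed

lemma square_sum3_le:
  fixes a b c :: real
  shows "(a + b + c)\<^sup>2 \<le> 3 * (a\<^sup>2 + b\<^sup>2 + c\<^sup>2)"
  using sum_squares_bound[of a b] sum_squares_bound[of b c] sum_squares_bound[of a c]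
  by (simp add: power2_eq_square algebra_simps)

subsection \<open>Deterministic error bounds\<close>

text \<open>\<open>G i\<close> plays the gradient of the empirical loss of client \<open>i\<close>; \<open>stationary\<close> and \<open>center\<close>
  are the first-order optimality conditions of Problem (P) with uniform weights.\<close>

locale coupled_system =
  fixes G :: "nat \<Rightarrow> 'v::real_inner \<Rightarrow> 'v" and m :: nat and \<mu> lam R :: real
    and ws w :: "nat \<Rightarrow> 'v" and wg wb :: 'v
  assumes m: "m \<ge> 1" and mu: "\<mu> > 0" and lam: "lam > 0"
    and mono: "\<And>i x y. i \<in> {1..m} \<Longrightarrow> (G i x - G i y) \<bullet> (x - y) \<ge> \<mu> * (norm (x - y))\<^sup>2"
    and stationary: "\<And>i. i \<in> {1..m} \<Longrightarrow> G i (w i) = lam *\<^sub>R (wg - w i)"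
    and center: "(\<Sum>i=1..m. wg - w i) = 0"
    and center_star: "(\<Sum>i=1..m. ws i - wb) = 0"
    and spread: "\<And>i. i \<in> {1..m} \<Longrightarrow> norm (ws i - wb) \<le> R"
begin

definition err :: "nat \<Rightarrow> real" where "err i = norm (w i - ws i)"
text \<open>How far the ground truth of a client is from being stationary for its own empirical
  loss.\<close>

definition noise :: "nat \<Rightarrow> real" where "noise i = norm (G i (ws i))"

lemma R_nonneg: "R \<ge> 0"
  using order_trans[OF norm_ge_zero spread[of 1]] m by simp

text \<open>Strong monotonicity between \<open>w i\<close> and \<open>ws i\<close> is tested against
  the error \<open>w i - ws i\<close>. Stationarity turns one gradient into the coupling term, and
  Young's inequality spends half of the quadratic term on the other.\<close>

lemma err_le_noise_minus_coupling:
  assumes i: "i \<in> {1..m}"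
  shows "\<mu> / 2 * (err i)\<^sup>2 + lam * ((w i - wg) \<bullet> (w i - ws i)) \<le> (noise i)\<^sup>2 / (2 * \<mu>)"
proof -
  have "\<mu> * (err i)\<^sup>2 \<le> (G i (w i) - G i (ws i)) \<bullet> (w i - ws i)"
    using mono[OF i] by (simp add: err_def)
  also have "\<dots> = - lam * ((w i - wg) \<bullet> (w i - ws i)) + - (G i (ws i) \<bullet> (w i - ws i))"
    by (simp add: stationary[OF i] inner_diff_left algebra_simps)
  also have "- (G i (ws i) \<bullet> (w i - ws i)) \<le> noise i * err i"
    unfolding noise_def err_def using Cauchy_Schwarz_ineq2[of "G i (ws i)" "w i - ws i"] by linarith
  also have "noise i * err i \<le> (noise i)\<^sup>2 / (2 * \<mu>) + \<mu> / 2 * (err i)\<^sup>2"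
    using mu by (rule mult_le_weighted_squares)
  finally show ?thesis by simp
qed

text \<open>Both centering conditions make \<open>wg\<close> and \<open>wb\<close> the means of the
  \<open>w i\<close> and the \<open>ws i\<close>, so their difference is the mean error vector and
  Cauchy-Schwarz applies.\<close>

lemma center_distance_sq: "(norm (wg - wb))\<^sup>2 \<le> (\<Sum>i=1..m. (err i)\<^sup>2) / real m"
proof -
  have "(\<Sum>i=1..m. w i - ws i) = (\<Sum>i=1..m. wg - wb) - (\<Sum>i=1..m. wg - w i) - (\<Sum>i=1..m. ws i - wb)"
    unfolding sum_subtractf[symmetric] by (intro sum.cong) auto
  then have *: "real m *\<^sub>R (wg - wb) = (\<Sum>i=1..m. w i - ws i)"
    using center center_star by (simp add: scaleR_right_diff_distrib of_nat_diff sum_constant_scaleR)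
  have "(real m)\<^sup>2 * (norm (wg - wb))\<^sup>2 = (norm (real m *\<^sub>R (wg - wb)))\<^sup>2"
    by (simp add: power_mult_distrib)
  also have "\<dots> \<le> real m * (\<Sum>i=1..m. (err i)\<^sup>2)"
    unfolding * err_def using norm_sum_squared_le[of "\<lambda>i. w i - ws i" "{1..m}"] by simp
  finally have "real m * (norm (wg - wb))\<^sup>2 \<le> (\<Sum>i=1..m. (err i)\<^sup>2)"
    using m by (simp add: power2_eq_square mult.assoc)
  then show ?thesis using m by (simp add: field_simps)
qed

lemma total_err_le:
  "(\<Sum>i=1..m. (err i)\<^sup>2) \<le> (\<Sum>i=1..m. (noise i)\<^sup>2) / \<mu>\<^sup>2 + real m * (lam * R\<^sup>2 / (2 * \<mu>))"
proof -
  \<comment> \<open>The two second factors differ by \<open>wg - wb\<close>, which does not depend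
    on \<open>i\<close> and therefore pairs to zero with the deviations from
    \<open>wg\<close>.\<close>
  have "(\<Sum>i=1..m. (w i - wg) \<bullet> (w i - ws i)) =
      (\<Sum>i=1..m. (w i - wg) \<bullet> ((w i - wg) + (wb - ws i)))"
  proof -
    have "(\<Sum>i=1..m. (w i - wg) \<bullet> (w i - ws i)) =
      (\<Sum>i=1..m. (w i - wg) \<bullet> ((w i - wg) + (wb - ws i)) - (wg - w i) \<bullet> (wg - wb))"
      by (intro sum.cong) (auto simp: inner_simps)
    also have "\<dots> = (\<Sum>i=1..m. (w i - wg) \<bullet> ((w i - wg) + (wb - ws i))) - (\<Sum>i=1..m. wg - w i) \<bullet> (wg - wb)"
      by (subst sum_subtractf) (simp only: inner_sum_left)
    finally show ?thesis using center by simp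
  qed
  \<comment> \<open>What is left besides the deviation has norm at most \<open>R\<close>, so each
    client loses at most a quarter of the squared radius.\<close>
  moreover have "(\<Sum>i=1..m. (w i - wg) \<bullet> ((w i - wg) + (wb - ws i))) \<ge> (\<Sum>i=1..m. - R\<^sup>2 / 4)"
  proof (rule sum_mono)
    fix i assume i: "i \<in> {1..m}"
    have "(norm (wb - ws i))\<^sup>2 \<le> R\<^sup>2"
      using spread[OF i] by (intro power_mono) (auto simp: norm_minus_commute)
    then show "- R\<^sup>2 / 4 \<le> (w i - wg) \<bullet> ((w i - wg) + (wb - ws i))"
      using inner_add_self_ge[of "wb - ws i" "w i - wg"] by simp
  qed
  ultimately have "(\<Sum>i=1..m. (w i - wg) \<bullet> (w i - ws i)) \<ge> - (real m * R\<^sup>2 / 4)" by simp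
  then have "lam * (\<Sum>i=1..m. (w i - wg) \<bullet> (w i - ws i)) \<ge> lam * (- (real m * R\<^sup>2 / 4))"
    using lam by (intro mult_left_mono) auto
  moreover have "(\<Sum>i=1..m. \<mu> / 2 * (err i)\<^sup>2 + lam * ((w i - wg) \<bullet> (w i - ws i)))
      \<le> (\<Sum>i=1..m. (noise i)\<^sup>2 / (2 * \<mu>))"
    by (intro sum_mono err_le_noise_minus_coupling)
  then have "\<mu> / 2 * (\<Sum>i=1..m. (err i)\<^sup>2) + lam * (\<Sum>i=1..m. (w i - wg) \<bullet> (w i - ws i))
      \<le> (\<Sum>i=1..m. (noise i)\<^sup>2) / (2 * \<mu>)"
    by (simp only: sum.distrib sum_distrib_left sum_divide_distrib)
  ultimately have "\<mu> / 2 * (\<Sum>i=1..m. (err i)\<^sup>2) \<le> (\<Sum>i=1..m. (noise i)\<^sup>2) / (2 * \<mu>) + lam * (real m * R\<^sup>2 / 4)"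
    by linarith
  then have "2 / \<mu> * (\<mu> / 2 * (\<Sum>i=1..m. (err i)\<^sup>2)) \<le>
      2 / \<mu> * ((\<Sum>i=1..m. (noise i)\<^sup>2) / (2 * \<mu>) + lam * (real m * R\<^sup>2 / 4))"
    using mu by (intro mult_left_mono) auto
  then show ?thesis using mu by (simp add: field_simps power2_eq_square)
qed

text \<open>For a single client the vector \<open>wg - wb\<close> no longer cancels. The square is
  completed with \<open>wg - ws i\<close> instead, whose size is controlled by the total error
  through the distance of the two centers.\<close>

lemma local_err_weak_coupling:
  assumes i: "i \<in> {1..m}"
  shows "(err i)\<^sup>2 \<le> (noise i)\<^sup>2 / \<mu>\<^sup>2
    + lam / \<mu> * (R\<^sup>2 + (\<Sum>k=1..m. (noise k)\<^sup>2) / (real m * \<mu>\<^sup>2) + lam * R\<^sup>2 / (2 * \<mu>))"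
proof -
  let ?v = "wg - ws i"
  have "(norm ?v)\<^sup>2 = (norm ((wg - wb) + (wb - ws i)))\<^sup>2" by simp
  also have "\<dots> \<le> 2 * (norm (wg - wb))\<^sup>2 + 2 * (norm (wb - ws i))\<^sup>2" by (rule norm_add_squared_le)
  also have "(norm (wb - ws i))\<^sup>2 \<le> R\<^sup>2"
    using spread[OF i] by (intro power_mono) (auto simp: norm_minus_commute)
  also have "(norm (wg - wb))\<^sup>2 \<le>
      ((\<Sum>k=1..m. (noise k)\<^sup>2) / \<mu>\<^sup>2 + real m * (lam * R\<^sup>2 / (2 * \<mu>))) / real m"
    by (rule order_trans[OF center_distance_sq]) (intro divide_right_mono total_err_le, simp)
  also have "\<dots> = (\<Sum>k=1..m. (noise k)\<^sup>2) / (real m * \<mu>\<^sup>2) + lam * R\<^sup>2 / (2 * \<mu>)"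
    using m mu by (simp add: field_simps)
  finally have v: "(norm ?v)\<^sup>2 \<le> 2 * (R\<^sup>2 + (\<Sum>k=1..m. (noise k)\<^sup>2) / (real m * \<mu>\<^sup>2) + lam * R\<^sup>2 / (2 * \<mu>))"
    by simp
  have "(w i - wg) \<bullet> (w i - ws i) \<ge> - (norm ?v)\<^sup>2 / 4"
    using inner_add_self_ge[of ?v "w i - wg"] by simp
  then have "lam * ((w i - wg) \<bullet> (w i - ws i)) \<ge> lam * (- (norm ?v)\<^sup>2 / 4)"
    using lam by (intro mult_left_mono) auto
  with err_le_noise_minus_coupling[OF i] have "\<mu> / 2 * (err i)\<^sup>2 \<le> (noise i)\<^sup>2 / (2 * \<mu>) + lam * ((norm ?v)\<^sup>2 / 4)"
    by (simp add: field_simps)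
  then have "2 / \<mu> * (\<mu> / 2 * (err i)\<^sup>2) \<le> 2 / \<mu> * ((noise i)\<^sup>2 / (2 * \<mu>) + lam * ((norm ?v)\<^sup>2 / 4))"
    using mu by (intro mult_left_mono) auto
  then have "(err i)\<^sup>2 \<le> (noise i)\<^sup>2 / \<mu>\<^sup>2 + lam / \<mu> * ((norm ?v)\<^sup>2 / 2)"
    using mu by (simp add: field_simps power2_eq_square)
  also have "\<dots> \<le> (noise i)\<^sup>2 / \<mu>\<^sup>2 + lam / \<mu> *
      (R\<^sup>2 + (\<Sum>k=1..m. (noise k)\<^sup>2) / (real m * \<mu>\<^sup>2) + lam * R\<^sup>2 / (2 * \<mu>))"
    using v lam mu by (intro add_left_mono mult_left_mono) (simp_all only: pos_divide_le_eq zero_less_numeral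
        mult.commute[of _ "2::real"], simp)
  finally show ?thesis .
qed

end

section \<open>Strong coupling: local models close to the global one\<close>

locale strongly_coupled_system = coupled_system +
  fixes L :: real
  assumes lip: "\<And>i x y. i \<in> {1..m} \<Longrightarrow> norm (G i x - G i y) \<le> L * norm (x - y)"
    and mu_le_L: "\<mu> \<le> L"
    and strong: "64 * (L / \<mu>)\<^sup>2 * L \<le> lam + \<mu>"
begin

text \<open>Since \<open>L / \<mu>\<close> is at least 1, \<open>strong\<close> gives lower bounds
  \<open>64 * (L / \<mu>) * L\<close> and \<open>64 * L\<close> for \<open>lam + \<mu>\<close>. The
  two resulting small factors let error terms be absorbed later.\<close>

lemma coupling_ratio: "L / (lam + \<mu>) \<le> 1 / 64"
  and coupling_ratio_sq: "L * (L / (lam + \<mu>)) \<le> \<mu> / 64"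
proof -
  have L: "L > 0" and q: "L / \<mu> \<ge> 1" using mu mu_le_L by auto
  have "(L / \<mu>) * 1 \<le> (L / \<mu>) * (L / \<mu>)" using q by (intro mult_left_mono) auto
  then have "64 * (L / \<mu>) * L \<le> 64 * ((L / \<mu>) * (L / \<mu>)) * L"
    using L by (intro mult_right_mono mult_left_mono) auto
  also have "\<dots> \<le> lam + \<mu>" using strong by (simp add: power2_eq_square)
  finally have 1: "64 * (L / \<mu>) * L \<le> lam + \<mu>" .
  moreover have "64 * 1 * L \<le> 64 * (L / \<mu>) * L"
    using q L by (intro mult_right_mono mult_left_mono) auto
  ultimately have "64 * L \<le> lam + \<mu>" by simp
  then show "L / (lam + \<mu>) \<le> 1 / 64" using lam mu by (simp add: field_simps)
  show "L * (L / (lam + \<mu>)) \<le> \<mu> / 64" using 1 lam mu by (simp add: field_simps)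
qed

text \<open>\<open>w i\<close> is the zero of a strongly monotone map with constant
  \<open>lam + \<mu>\<close>, namely \<open>G i\<close> plus the coupling force. Its distance to
  \<open>wg\<close> is thus at most the size of that map at \<open>wg\<close>, which is
  \<open>norm (G i wg)\<close>, divided by the constant.\<close>

lemma local_deviation_le:
  assumes i: "i \<in> {1..m}"
  shows "norm (w i - wg) \<le> (noise i + L * (R + norm (wg - wb))) / (lam + \<mu>)"
proof -
  have "\<mu> * (norm (w i - wg))\<^sup>2 \<le> (G i (w i) - G i wg) \<bullet> (w i - wg)"
    using mono[OF i] .
  also have "\<dots> = - lam * (norm (w i - wg))\<^sup>2 + - (G i wg \<bullet> (w i - wg))"
    by (simp add: stationary[OF i] power2_norm_eq_inner inner_simps algebra_simps)
  also have "- (G i wg \<bullet> (w i - wg)) \<le> norm (G i wg) * norm (w i - wg)"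
    using Cauchy_Schwarz_ineq2[of "G i wg" "w i - wg"] by linarith
  finally have "(lam + \<mu>) * norm (w i - wg) * norm (w i - wg) \<le> norm (G i wg) * norm (w i - wg)"
    by (simp add: algebra_simps power2_eq_square)
  then have "(lam + \<mu>) * norm (w i - wg) \<le> norm (G i wg)"
    by (cases "norm (w i - wg) = 0") (simp_all add: mult_le_cancel_right)
  also have "\<dots> \<le> noise i + norm (G i wg - G i (ws i))"
    unfolding noise_def using norm_triangle_ineq[of "G i (ws i)" "G i wg - G i (ws i)"] by simp
  also have "norm (G i wg - G i (ws i)) \<le> L * norm (wg - ws i)" by (rule lip[OF i])
  also have "\<dots> \<le> L * (R + norm (wg - wb))"
    using spread[OF i] norm_triangle_ineq[of "wg - wb" "wb - ws i"] mu mu_le_L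
    by (intro mult_left_mono) (auto simp: norm_minus_commute)
  finally show ?thesis using lam mu by (simp add: field_simps)
qed

text \<open>The norm of the average profits from cancellation between independent centred gradients;
  the average of the norms in \<open>mean_noise\<close> does not, and will occur only with the small
  factor \<open>L / (lam + \<mu>)\<close>.\<close>

definition mean_grad_norm :: real where "mean_grad_norm = norm (\<Sum>i=1..m. G i (ws i)) / real m"
definition mean_noise :: real where "mean_noise = (\<Sum>i=1..m. noise i) / real m"

text \<open>The gradients at the local models sum to zero, so the average gradient vanishes at \<open>wg\<close>
  up to the deviations of the local models from \<open>wg\<close>, and it is strongly monotone.\<close>

lemma global_err_le:
  "\<mu> * norm (wg - wb) \<le> 64 / 63 * (mean_grad_norm + 65 / 64 * (L * R) + L / (lam + \<mu>) * mean_noise)"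
proof -
  define t where "t = norm (wg - wb)"
  define \<Lambda> where "\<Lambda> = lam + \<mu>"
  have L: "L > 0" and La: "\<Lambda> > 0" using mu mu_le_L lam by (auto simp: \<Lambda>_def)
  have zero: "(\<Sum>i=1..m. G i (w i)) = 0"
  proof -
    have "(\<Sum>i=1..m. G i (w i)) = lam *\<^sub>R (\<Sum>i=1..m. wg - w i)"
      unfolding scaleR_right.sum by (intro sum.cong) (auto simp: stationary)
    then show ?thesis using center by simp
  qed
  have "real m * (\<mu> * t\<^sup>2) = (\<Sum>i=1..m. \<mu> * (norm (wg - wb))\<^sup>2)" by (simp add: t_def)
  also have "\<dots> \<le> (\<Sum>i=1..m. (G i wg - G i wb) \<bullet> (wg - wb))"
    by (intro sum_mono mono)
  also have "\<dots> = (\<Sum>i=1..m. G i wg - G i wb) \<bullet> (wg - wb)" by (simp add: inner_sum_left)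
  also have "\<dots> \<le> norm (\<Sum>i=1..m. G i wg - G i wb) * t"
    unfolding t_def by (rule norm_cauchy_schwarz)
  \<comment> \<open>Using the vanishing sum of local gradients, the difference splits into a
    deviation part, a heterogeneity part of order \<open>L * R\<close>, and the pure noise.\<close>
  also have "(\<Sum>i=1..m. G i wg - G i wb) = (\<Sum>i=1..m. G i wg - G i (w i)) +
      (\<Sum>i=1..m. G i (ws i) - G i wb) - (\<Sum>i=1..m. G i (ws i))"
    using zero by (simp add: sum_subtractf)
  also have "norm \<dots> \<le> norm (\<Sum>i=1..m. G i wg - G i (w i)) +
      norm (\<Sum>i=1..m. G i (ws i) - G i wb) + norm (\<Sum>i=1..m. G i (ws i))"
    by (meson norm_triangle_ineq norm_triangle_ineq4 add_mono order_refl order_trans)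
  also have "norm (\<Sum>i=1..m. G i (ws i)) = real m * mean_grad_norm"
    using m by (simp add: mean_grad_norm_def)
  also have "norm (\<Sum>i=1..m. G i (ws i) - G i wb) \<le> (\<Sum>i=1..m. L * R)"
    using lip spread L by (intro sum_norm_le) (meson mult_left_mono order_trans less_imp_le)
  also have "norm (\<Sum>i=1..m. G i wg - G i (w i)) \<le> (\<Sum>i=1..m. L * ((noise i + L * (R + t)) / \<Lambda>))"
  proof (rule sum_norm_le)
    fix i assume i: "i \<in> {1..m}"
    have "norm (G i wg - G i (w i)) \<le> L * norm (wg - w i)" by (rule lip[OF i])
    also have "\<dots> \<le> L * ((noise i + L * (R + t)) / \<Lambda>)"
      using local_deviation_le[OF i] L
      by (intro mult_left_mono) (auto simp: norm_minus_commute t_def \<Lambda>_def)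
    finally show "norm (G i wg - G i (w i)) \<le> L * ((noise i + L * (R + t)) / \<Lambda>)" .
  qed
  also have "(\<Sum>i=1..m. L * ((noise i + L * (R + t)) / \<Lambda>))
      = real m * (L / \<Lambda> * mean_noise + L * (L / \<Lambda>) * (R + t))"
  proof -
    have "(\<Sum>i=1..m. L * ((noise i + L * (R + t)) / \<Lambda>)) = (\<Sum>i=1..m. L / \<Lambda> * noise i + L * (L / \<Lambda>) * (R + t))"
      by (intro sum.cong) (auto simp: algebra_simps add_divide_distrib)
    also have "\<dots> = L / \<Lambda> * (\<Sum>i=1..m. noise i) + real m * (L * (L / \<Lambda>) * (R + t))"
      by (simp add: sum.distrib sum_distrib_left)
    also have "(\<Sum>i=1..m. noise i) = real m * mean_noise" using m by (simp add: mean_noise_def)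
    finally show ?thesis by (simp add: algebra_simps)
  qed
  finally have "real m * (\<mu> * t\<^sup>2) \<le> (real m * (L / \<Lambda> * mean_noise + L * (L / \<Lambda>) * (R + t))
      + (\<Sum>i=1..m. L * R) + real m * mean_grad_norm) * t"
    by (simp add: t_def mult_right_mono)
  also have "\<dots> = real m * ((L / \<Lambda> * mean_noise + L * (L / \<Lambda>) * (R + t) + L * R + mean_grad_norm) * t)"
    by (simp add: algebra_simps)
  finally have "(\<mu> * t) * t \<le> (L / \<Lambda> * mean_noise + L * (L / \<Lambda>) * (R + t) + L * R + mean_grad_norm) * t"
    using m by (simp add: power2_eq_square mult.assoc)
  moreover have nn: "0 \<le> mean_noise" "0 \<le> mean_grad_norm"
    by (auto simp: mean_noise_def mean_grad_norm_def noise_def intro!: divide_nonneg_nonneg sum_nonneg)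
  \<comment> \<open>One factor \<open>t\<close> is divided out; for \<open>t = 0\<close> the bound
    holds because its right-hand side is nonnegative.\<close>
  ultimately have "\<mu> * t \<le> L / \<Lambda> * mean_noise + L * (L / \<Lambda>) * (R + t) + L * R + mean_grad_norm"
    if "t \<noteq> 0"
    using that by (simp add: t_def mult_le_cancel_right)
  moreover have "0 \<le> L / \<Lambda> * mean_noise + L * (L / \<Lambda>) * R + L * R + mean_grad_norm"
    using nn L La R_nonneg by (intro add_nonneg_nonneg mult_nonneg_nonneg) auto
  ultimately have "\<mu> * t \<le> L / \<Lambda> * mean_noise + L * (L / \<Lambda>) * R + L * (L / \<Lambda>) * t + L * R + mean_grad_norm"
    by (cases "t = 0") (auto simp: algebra_simps add_divide_distrib)
  moreover have "L * (L / \<Lambda>) * t \<le> 1 / 64 * (\<mu> * t)"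
    using mult_right_mono[OF coupling_ratio_sq, of t] by (simp add: t_def \<Lambda>_def)
  moreover have "L * (L / \<Lambda>) * R \<le> 1 / 64 * (L * R)"
  proof -
    have "L / \<Lambda> * (L * R) \<le> 1 / 64 * (L * R)"
      using coupling_ratio L R_nonneg by (intro mult_right_mono) (auto simp: \<Lambda>_def)
    then show ?thesis by (simp add: ac_simps)
  qed
  \<comment> \<open>The term in \<open>t\<close> is moved to the left, leaving the factor 63/64
    there; the extra \<open>R\<close> term raises the coefficient of \<open>L * R\<close> from 1 to
    65/64.\<close>
  moreover have "x \<le> 64 / 63 * (n + 65 / 64 * l + c)"
    if "x \<le> c + d + e + l + n" "e \<le> 1 / 64 * x" "d \<le> 1 / 64 * l" for x c d e l n :: real
    using that by simp
  ultimately show ?thesis unfolding t_def[symmetric] \<Lambda>_def[symmetric] by blast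
qed

text \<open>Squaring a sum of three terms costs a factor 3, and the numerical factors stay below 4
  because 3 * (65/63)^2 < 4. Cauchy-Schwarz replaces the squared mean of the noise by a mean of
  squares, whose expectation can be bounded.\<close>

lemma global_err_sq_le:
  "\<mu>\<^sup>2 * (norm (wg - wb))\<^sup>2 \<le> 4 * ((norm (\<Sum>i=1..m. G i (ws i)) / real m)\<^sup>2 + L\<^sup>2 * R\<^sup>2
      + (L / (lam + \<mu>))\<^sup>2 * ((\<Sum>i=1..m. (noise i)\<^sup>2) / real m))"
proof -
  let ?r = "L / (lam + \<mu>)"
  have "(\<mu> * norm (wg - wb))\<^sup>2 \<le> (64 / 63 * (mean_grad_norm + 65 / 64 * (L * R) + ?r * mean_noise))\<^sup>2"
    using mu by (intro power_mono global_err_le) auto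
  also have "\<dots> \<le> (64 / 63)\<^sup>2 * (3 * (mean_grad_norm\<^sup>2 + (65 / 64 * (L * R))\<^sup>2 + (?r * mean_noise)\<^sup>2))"
    unfolding power_mult_distrib[of "64 / 63"] by (intro mult_left_mono square_sum3_le) auto
  also have "\<dots> \<le> 4 * (mean_grad_norm\<^sup>2 + L\<^sup>2 * R\<^sup>2 + ?r\<^sup>2 * mean_noise\<^sup>2)"
  proof -
    have *: "(64 / 63)\<^sup>2 * (3 * (a\<^sup>2 + (65 / 64 * b)\<^sup>2 + c\<^sup>2)) \<le> 4 * (a\<^sup>2 + b\<^sup>2 + c\<^sup>2)"
      for a b c :: real
      by (simp add: power_mult_distrib power_divide)
    show ?thesis using *[of mean_grad_norm "L * R" "?r * mean_noise"] by (simp only: power_mult_distrib)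
  qed
  also have "mean_noise\<^sup>2 \<le> (\<Sum>i=1..m. (noise i)\<^sup>2) / real m"
  proof -
    have "mean_noise\<^sup>2 \<le> (real m * (\<Sum>i=1..m. (noise i)\<^sup>2)) / (real m)\<^sup>2"
      unfolding mean_noise_def power_divide
      using norm_sum_squared_le[of noise "{1..m}"] by (intro divide_right_mono) auto
    then show ?thesis using m by (simp add: power2_eq_square)
  qed
  finally show ?thesis
    by (simp add: power_mult_distrib mean_grad_norm_def mult_left_mono)
qed

text \<open>The error splits into the deviation from \<open>wg\<close>, the error of
  \<open>wg\<close>, and the spread of the ground truths. Again three squares cost a factor 3, and 3
  * (65/64)^2 < 4.\<close>

lemma local_err_strong_coupling:
  assumes i: "i \<in> {1..m}"
  shows "(err i)\<^sup>2 \<le> 4 * (noise i)\<^sup>2 / (lam + \<mu>)\<^sup>2 + 4 * R\<^sup>2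
    + 16 / \<mu>\<^sup>2 * ((norm (\<Sum>i=1..m. G i (ws i)) / real m)\<^sup>2 + L\<^sup>2 * R\<^sup>2
      + (L / (lam + \<mu>))\<^sup>2 * ((\<Sum>i=1..m. (noise i)\<^sup>2) / real m))"
proof -
  define t where "t = norm (wg - wb)"
  define \<Lambda> where "\<Lambda> = lam + \<mu>"
  have La: "\<Lambda> > 0" using mu lam by (auto simp: \<Lambda>_def)
  have "err i = norm ((w i - wg) + (wg - wb) - (ws i - wb))" by (simp add: err_def)
  also have "\<dots> \<le> norm (w i - wg) + norm (wg - wb) + norm (ws i - wb)"
    by (meson norm_triangle_ineq norm_triangle_ineq4 add_mono order_refl order_trans)
  also have "\<dots> \<le> (noise i + L * (R + t)) / \<Lambda> + t + R"
    using local_deviation_le[OF i] spread[OF i] by (simp add: t_def \<Lambda>_def)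
  also have "(noise i + L * (R + t)) / \<Lambda> = noise i / \<Lambda> + L / \<Lambda> * (R + t)"
    using La by (simp add: field_simps)
  also have "L / \<Lambda> * (R + t) \<le> 1 / 64 * (R + t)"
    using coupling_ratio R_nonneg by (intro mult_right_mono) (auto simp: t_def \<Lambda>_def)
  finally have "err i \<le> noise i / \<Lambda> + 65 / 64 * t + 65 / 64 * R" by (simp add: field_simps)
  then have "(err i)\<^sup>2 \<le> (noise i / \<Lambda> + 65 / 64 * t + 65 / 64 * R)\<^sup>2"
    by (intro power_mono) (auto simp: err_def)
  also have "\<dots> \<le> 3 * ((noise i / \<Lambda>)\<^sup>2 + (65 / 64 * t)\<^sup>2 + (65 / 64 * R)\<^sup>2)"
    by (rule square_sum3_le)
  also have "\<dots> \<le> 4 * (noise i / \<Lambda>)\<^sup>2 + 4 * R\<^sup>2 + 4 * t\<^sup>2"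
  proof -
    have "3 * (x + (65 / 64)\<^sup>2 * y + (65 / 64)\<^sup>2 * z) \<le> 4 * x + 4 * z + 4 * y"
      if "x \<ge> 0" "y \<ge> 0" "z \<ge> 0" for x y z :: real
      using that by (simp add: power_divide)
    then show ?thesis unfolding power_mult_distrib[of "65 / 64"] by simp
  qed
  also have "4 * t\<^sup>2 = 4 / \<mu>\<^sup>2 * (\<mu>\<^sup>2 * t\<^sup>2)" using mu by simp
  also have "\<dots> \<le> 4 / \<mu>\<^sup>2 * (4 * ((norm (\<Sum>i=1..m. G i (ws i)) / real m)\<^sup>2 + L\<^sup>2 * R\<^sup>2
      + (L / \<Lambda>)\<^sup>2 * ((\<Sum>i=1..m. (noise i)\<^sup>2) / real m)))"
    unfolding t_def \<Lambda>_def by (intro mult_left_mono global_err_sq_le) auto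
  finally show ?thesis by (simp add: \<Lambda>_def power_divide)
qed

end

subsection \<open>Smooth losses and the mean of their gradients\<close>

lemma DERIV_along_line:
  fixes f :: "'v::euclidean_space \<Rightarrow> real"
  assumes "f differentiable (at (x + t *\<^sub>R h))"
  shows "((\<lambda>t. f (x + t *\<^sub>R h)) has_real_derivative grad f (x + t *\<^sub>R h) \<bullet> h) (at t)"
proof -
  have "(f has_derivative (\<lambda>h'. h' \<bullet> grad f (x + t *\<^sub>R h))) (at (x + t *\<^sub>R h))"
    using GDERIV_grad[OF assms] by (simp add: gderiv_def)
  moreover have "((\<lambda>t. x + t *\<^sub>R h) has_derivative (\<lambda>s. s *\<^sub>R h)) (at t)"
    by (auto intro!: derivative_eq_intros)
  ultimately have "((\<lambda>t. f (x + t *\<^sub>R h)) has_derivative (\<lambda>s. (s *\<^sub>R h) \<bullet> grad f (x + t *\<^sub>R h))) (at t)"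
    using has_derivative_compose by blast
  then show ?thesis
    unfolding has_field_derivative_def by (rule has_derivative_eq_rhs) (auto simp: inner_commute mult.commute)
qed

text \<open>A weak descent lemma from the mean value theorem on the segment. The constant is twice
  the usual one, but only the quadratic order of the remainder matters for the first-order condition
  below.\<close>

lemma smooth_upper_bound:
  fixes f :: "'v::euclidean_space \<Rightarrow> real"
  assumes diff: "\<And>x. f differentiable (at x)"
    and lip: "\<And>x y. norm (grad f x - grad f y) \<le> L * norm (x - y)"
  shows "f (x + h) \<le> f x + grad f x \<bullet> h + \<bar>L\<bar> * (norm h)\<^sup>2"
proof -
  obtain t :: real where t: "0 < t" "t < 1" and eq: "f (x + 1 *\<^sub>R h) - f (x + 0 *\<^sub>R h) = (1 - 0) * (grad f (x + t *\<^sub>R h) \<bullet> h)"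
    using MVT2[of 0 1 "\<lambda>t. f (x + t *\<^sub>R h)" "\<lambda>t. grad f (x + t *\<^sub>R h) \<bullet> h"] DERIV_along_line[OF diff]
    by fastforce
  have "(grad f (x + t *\<^sub>R h) - grad f x) \<bullet> h \<le> norm (grad f (x + t *\<^sub>R h) - grad f x) * norm h"
    by (rule norm_cauchy_schwarz)
  also have "\<dots> \<le> (\<bar>L\<bar> * norm h) * norm h"
  proof (rule mult_right_mono)
    have "norm (grad f (x + t *\<^sub>R h) - grad f x) \<le> L * (t * norm h)"
      using lip[of "x + t *\<^sub>R h" x] t by simp
    also have "\<dots> \<le> \<bar>L\<bar> * (1 * norm h)"
      using t by (intro mult_mono) auto
    finally show "norm (grad f (x + t *\<^sub>R h) - grad f x) \<le> \<bar>L\<bar> * norm h" by simp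
  qed simp
  finally show ?thesis using eq by (simp add: inner_diff_left power2_eq_square algebra_simps)
qed

text \<open>Each coordinate of the gradient is a limit of measurable difference quotients along the
  nonzero steps 1/(k+1).\<close>

lemma grad_measurable:
  fixes f :: "'v::euclidean_space \<Rightarrow> 'z \<Rightarrow> real"
  assumes meas: "\<And>v. f v \<in> borel_measurable N"
    and diff: "\<And>z. z \<in> space N \<Longrightarrow> (\<lambda>v. f v z) differentiable (at w)"
  shows "(\<lambda>z. grad (\<lambda>v. f v z) w) \<in> borel_measurable N"
proof (subst borel_measurable_euclidean_space, intro ballI)
  fix b :: 'v
  show "(\<lambda>z. grad (\<lambda>v. f v z) w \<bullet> b) \<in> borel_measurable N"
  proof (rule borel_measurable_LIMSEQ_metric)
    show "(\<lambda>z. (f (w + inverse (real (Suc k)) *\<^sub>R b) z - f w z) / inverse (real (Suc k))) \<in> borel_measurable N" for k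
      using meas by measurable
    fix z assume z: "z \<in> space N"
    have "((\<lambda>t. f (w + t *\<^sub>R b) z) has_real_derivative grad (\<lambda>v. f v z) w \<bullet> b) (at 0)"
      using DERIV_along_line[of "\<lambda>v. f v z" w 0 b] diff[OF z] by simp
    then have "((\<lambda>t. (f (w + t *\<^sub>R b) z - f w z) / t) \<longlongrightarrow> grad (\<lambda>v. f v z) w \<bullet> b) (at 0)"
      by (simp add: DERIV_def)
    moreover have "filterlim (\<lambda>k. inverse (real (Suc k))) (at 0) sequentially"
      using LIMSEQ_inverse_real_of_nat by (simp add: filterlim_at)
    ultimately show "(\<lambda>k. (f (w + inverse (real (Suc k)) *\<^sub>R b) z - f w z) / inverse (real (Suc k)))
        \<longlonglongrightarrow> grad (\<lambda>v. f v z) w \<bullet> b"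
      by (rule filterlim_compose)
  qed
qed

section \<open>Centred gradients and second moments of independent sums\<close>

lemma linear_term_zero:
  fixes a C :: real
  assumes "\<And>t. 0 \<le> t * a + C * t\<^sup>2"
  shows "a = 0"
proof -
  define c where "c = \<bar>C\<bar> + 1"
  have c: "c > 0" "C \<le> c" by (auto simp: c_def)
  \<comment> \<open>The inserted \<open>t\<close> minimizes \<open>t * a + c * t\<^sup>2\<close>;
    the summand 1 in \<open>c\<close> keeps the denominator positive.\<close>
  have "0 \<le> (- a / (2 * c)) * a + C * (- a / (2 * c))\<^sup>2" by (rule assms)
  also have "\<dots> \<le> (- a / (2 * c)) * a + c * (- a / (2 * c))\<^sup>2"
    using c by (intro add_left_mono mult_right_mono) auto
  also have "\<dots> = - (a\<^sup>2 / (4 * c))" using c by (simp add: field_simps power2_eq_square)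
  finally show ?thesis using c by (simp add: divide_le_0_iff)
qed

lemma (in prob_space) integrable_if_norm_sq:
  fixes X :: "'a \<Rightarrow> 'v::{banach, second_countable_topology}"
  assumes "X \<in> borel_measurable M" "integrable M (\<lambda>\<omega>. (norm (X \<omega>))\<^sup>2)"
  shows "integrable M X"
proof (rule Bochner_Integration.integrable_bound)
  show "integrable M (\<lambda>\<omega>. 1 + (norm (X \<omega>))\<^sup>2)" using assms by simp
  have "norm x \<le> 1 + (norm x)\<^sup>2" for x :: 'v
    using sum_squares_bound[of "norm x" 1] norm_ge_zero[of x] unfolding one_power2 mult_1_right by linarith
  then show "AE \<omega> in M. norm (X \<omega>) \<le> norm (1 + (norm (X \<omega>))\<^sup>2)" by simp
qed (use assms in simp)

text \<open>The first-order condition of the population risk, obtained without differentiating under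
  the integral: the quadratic upper bound is integrated along a line through the minimizer, and its
  linear coefficient must vanish.\<close>

lemma ground_truth_grad_mean_zero:
  fixes loss :: "'v::euclidean_space \<Rightarrow> 'z \<Rightarrow> real"
  assumes prob: "prob_space D" and truth: "ground_truth loss D w"
    and diff: "\<And>z v. z \<in> space D \<Longrightarrow> (\<lambda>v. loss v z) differentiable (at v)"
    and lip: "\<And>x y z. z \<in> space D \<Longrightarrow>
      norm (grad (\<lambda>v. loss v z) x - grad (\<lambda>v. loss v z) y) \<le> L * norm (x - y)"
    and sq: "integrable D (\<lambda>z. (norm (grad (\<lambda>v. loss v z) w))\<^sup>2)"
  shows "integrable D (\<lambda>z. grad (\<lambda>v. loss v z) w)" (is "integrable D ?g")
    and "(\<integral>z. grad (\<lambda>v. loss v z) w \<partial>D) = 0"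
proof -
  interpret prob_space D by (rule prob)
  have int: "integrable D (loss v)" for v using truth by (simp add: ground_truth_def)
  have "?g \<in> borel_measurable D"
    using int diff by (intro grad_measurable) auto
  then show g: "integrable D ?g" using sq by (rule integrable_if_norm_sq)
  have "(\<integral>z. ?g z \<partial>D) \<bullet> b = 0" for b
  proof (rule linear_term_zero)
    fix t :: real
    have "0 \<le> (\<integral>z. loss (w + t *\<^sub>R b) z \<partial>D) - (\<integral>z. loss w z \<partial>D)"
      using truth by (simp add: ground_truth_def is_arg_min_linorder)
    also have "\<dots> = (\<integral>z. loss (w + t *\<^sub>R b) z - loss w z \<partial>D)"
      using int by simp
    also have "\<dots> \<le> (\<integral>z. ?g z \<bullet> (t *\<^sub>R b) + \<bar>L\<bar> * (norm (t *\<^sub>R b))\<^sup>2 \<partial>D)"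
    proof (rule integral_mono)
      show "integrable D (\<lambda>z. ?g z \<bullet> (t *\<^sub>R b) + \<bar>L\<bar> * (norm (t *\<^sub>R b))\<^sup>2)"
        using g by (intro Bochner_Integration.integrable_add integrable_inner_left) auto
      show "loss (w + t *\<^sub>R b) z - loss w z \<le> ?g z \<bullet> (t *\<^sub>R b) + \<bar>L\<bar> * (norm (t *\<^sub>R b))\<^sup>2"
        if "z \<in> space D" for z
        using smooth_upper_bound[of "\<lambda>v. loss v z" L w "t *\<^sub>R b"] diff lip that by simp
    qed (use int in simp)
    also have "\<dots> = (\<integral>z. ?g z \<bullet> (t *\<^sub>R b) \<partial>D) + \<bar>L\<bar> * (norm (t *\<^sub>R b))\<^sup>2"
      using g by (subst Bochner_Integration.integral_add) (auto simp: prob_space)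
    also have "(\<integral>z. ?g z \<bullet> (t *\<^sub>R b) \<partial>D) = t * ((\<integral>z. ?g z \<partial>D) \<bullet> b)"
      using g by (subst integral_inner_left) auto
    finally show "0 \<le> t * ((\<integral>z. ?g z \<partial>D) \<bullet> b) + \<bar>L\<bar> * (norm b)\<^sup>2 * t\<^sup>2"
      by (simp add: power_mult_distrib ac_simps)
  qed
  then show "(\<integral>z. ?g z \<partial>D) = 0" by (metis inner_eq_zero_iff)
qed

text \<open>Expanding the square, the off-diagonal inner products have expectation zero. This is
  where averaging over samples gains its factor.\<close>

lemma (in prob_space) indep_mean_zero_second_moment:
  fixes X :: "'i \<Rightarrow> 'a \<Rightarrow> 'v::euclidean_space"
  assumes fin: "finite I" and indep: "indep_vars (\<lambda>_. borel) X I"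
    and sq: "\<And>i. i \<in> I \<Longrightarrow> integrable M (\<lambda>\<omega>. (norm (X i \<omega>))\<^sup>2)"
    and zero: "\<And>i. i \<in> I \<Longrightarrow> expectation (X i) = 0"
  shows "integrable M (\<lambda>\<omega>. (norm (\<Sum>i\<in>I. X i \<omega>))\<^sup>2)"
    and "expectation (\<lambda>\<omega>. (norm (\<Sum>i\<in>I. X i \<omega>))\<^sup>2) = (\<Sum>i\<in>I. expectation (\<lambda>\<omega>. (norm (X i \<omega>))\<^sup>2))"
proof -
  have meas: "X i \<in> borel_measurable M" if "i \<in> I" for i
    using indep that by (auto simp: indep_vars_def)
  have int: "integrable M (X i)" if "i \<in> I" for i
    by (rule integrable_if_norm_sq[OF meas[OF that] sq[OF that]])
  have cross: "integrable M (\<lambda>\<omega>. X i \<omega> \<bullet> X j \<omega>)" "expectation (\<lambda>\<omega>. X i \<omega> \<bullet> X j \<omega>) = 0"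
    if ij: "i \<in> I" "j \<in> I" "i \<noteq> j" for i j
  proof -
    \<comment> \<open>Inner products are treated coordinate by coordinate, where the product rule
      for independent real random variables applies.\<close>
    have *: "integrable M (\<lambda>\<omega>. (X i \<omega> \<bullet> b) * (X j \<omega> \<bullet> b))"
      "expectation (\<lambda>\<omega>. (X i \<omega> \<bullet> b) * (X j \<omega> \<bullet> b)) = 0" for b
    proof -
      have ind: "indep_vars (\<lambda>_. borel) (\<lambda>k \<omega>. X k \<omega> \<bullet> b) {i, j}"
      proof (rule indep_vars_compose2[where X = X and Y = "\<lambda>_ x. x \<bullet> b"])
        show "indep_vars (\<lambda>_. borel) X {i, j}" using ij by (intro indep_vars_subset[OF indep]) auto
      qed simp
      have ints: "integrable M (\<lambda>\<omega>. X k \<omega> \<bullet> b)" if "k \<in> {i, j}" for k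
        using int ij that by (intro integrable_inner_left) auto
      show "integrable M (\<lambda>\<omega>. (X i \<omega> \<bullet> b) * (X j \<omega> \<bullet> b))"
        using indep_vars_integrable[OF _ ind ints] ij by simp
      have "expectation (\<lambda>\<omega>. X i \<omega> \<bullet> b) = 0"
        using int zero ij by (simp add: integral_inner_left)
      then show "expectation (\<lambda>\<omega>. (X i \<omega> \<bullet> b) * (X j \<omega> \<bullet> b)) = 0"
        using indep_vars_lebesgue_integral[OF _ ind ints] ij by simp
    qed
    show "integrable M (\<lambda>\<omega>. X i \<omega> \<bullet> X j \<omega>)" "expectation (\<lambda>\<omega>. X i \<omega> \<bullet> X j \<omega>) = 0"
      unfolding euclidean_inner[of "X i _" "X j _"] using * by simp_all
  qed
  have prod: "integrable M (\<lambda>\<omega>. X i \<omega> \<bullet> X j \<omega>)" if "i \<in> I" "j \<in> I" for i j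
    using cross sq that by (cases "i = j") (auto simp: power2_norm_eq_inner)
  have eq: "(norm (\<Sum>i\<in>I. X i \<omega>))\<^sup>2 = (\<Sum>i\<in>I. \<Sum>j\<in>I. X i \<omega> \<bullet> X j \<omega>)" for \<omega>
    unfolding power2_norm_eq_inner inner_sum_left by (simp only: inner_sum_right)
  show "integrable M (\<lambda>\<omega>. (norm (\<Sum>i\<in>I. X i \<omega>))\<^sup>2)"
    unfolding eq using prod by simp
  have "expectation (\<lambda>\<omega>. (norm (\<Sum>i\<in>I. X i \<omega>))\<^sup>2) = (\<Sum>i\<in>I. \<Sum>j\<in>I. expectation (\<lambda>\<omega>. X i \<omega> \<bullet> X j \<omega>))"
    unfolding eq using prod by (simp add: integral_sum)
  also have "\<dots> = (\<Sum>i\<in>I. expectation (\<lambda>\<omega>. X i \<omega> \<bullet> X i \<omega>))"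
  proof (rule sum.cong[OF refl])
    fix i assume i: "i \<in> I"
    show "(\<Sum>j\<in>I. expectation (\<lambda>\<omega>. X i \<omega> \<bullet> X j \<omega>)) = expectation (\<lambda>\<omega>. X i \<omega> \<bullet> X i \<omega>)"
      using fin i cross(2)[OF i] by (subst sum.remove[of _ i]) (auto intro!: sum.neutral)
  qed
  finally show "expectation (\<lambda>\<omega>. (norm (\<Sum>i\<in>I. X i \<omega>))\<^sup>2) = (\<Sum>i\<in>I. expectation (\<lambda>\<omega>. (norm (X i \<omega>))\<^sup>2))"
    by (simp add: power2_norm_eq_inner)
qed

subsection \<open>Measurability of the solution\<close>

text \<open>A well-conditioned minimizer is a pointwise limit of the first near-minimizers in a
  countable minimizing family, which are measurable.\<close>

lemma measurable_minimizer:
  fixes F :: "nat \<Rightarrow> 'a \<Rightarrow> real" and h :: "nat \<Rightarrow> 'v::metric_space"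
  assumes meas: "\<And>k. F k \<in> borel_measurable M" and c: "c > 0"
    and growth: "\<And>k \<omega>. \<omega> \<in> space M \<Longrightarrow> V \<omega> + c * (dist (h k) (W \<omega>))\<^sup>2 \<le> F k \<omega>"
    and approx: "\<And>\<omega> e. \<omega> \<in> space M \<Longrightarrow> e > 0 \<Longrightarrow> \<exists>k. F k \<omega> < V \<omega> + e"
  shows "W \<in> borel_measurable M"
proof -
  \<comment> \<open>Near-minimality is tested against every \<open>F l\<close> rather than against
    \<open>V\<close>, whose measurability is not given. Countably many measurable conditions make
    the least such index measurable.\<close>
  define P where "P k j \<omega> \<longleftrightarrow> (\<forall>l. F j \<omega> \<le> F l \<omega> + 1 / real (Suc k))" for k j \<omega>
  define J where "J k \<omega> = (LEAST j. P k j \<omega>)" for k \<omega>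
  have [measurable]: "Measurable.pred M (P k j)" for k j
    unfolding P_def using meas by measurable
  have J: "J k \<in> measurable M (count_space UNIV)" for k
    unfolding J_def by measurable
  show ?thesis
  proof (rule borel_measurable_LIMSEQ_metric)
    show "(\<lambda>\<omega>. h (J k \<omega>)) \<in> borel_measurable M" for k
      using J by (rule measurable_compose) simp
    fix \<omega> assume \<omega>: "\<omega> \<in> space M"
    have V: "V \<omega> \<le> F l \<omega>" for l 
      using order_trans[OF _ growth[OF \<omega>, of l]] c by simp
    have bound: "(dist (h (J k \<omega>)) (W \<omega>))\<^sup>2 \<le> 1 / c * inverse (real (Suc k))" for k
    proof -
      obtain j where j: "F j \<omega> < V \<omega> + 1 / real (Suc k)" using approx[OF \<omega>, of "1 / real (Suc k)"] by auto
      have "P k j \<omega>" unfolding P_def using V j by (smt (verit))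
      then have PJ: "P k (J k \<omega>) \<omega>" unfolding J_def by (rule LeastI)
      \<comment> \<open>Since the \<open>F l\<close> come arbitrarily close to \<open>V\<close>,
        comparison with all of them passes to comparison with \<open>V\<close>.\<close>
      have "F (J k \<omega>) \<omega> \<le> V \<omega> + 1 / real (Suc k)"
      proof (rule field_le_epsilon)
        fix e :: real assume "e > 0"
        then obtain l where "F l \<omega> < V \<omega> + e" using approx[OF \<omega>] by blast
        then show "F (J k \<omega>) \<omega> \<le> V \<omega> + 1 / real (Suc k) + e" using PJ unfolding P_def by (smt (verit))
      qed
      then have "c * (dist (h (J k \<omega>)) (W \<omega>))\<^sup>2 \<le> inverse (real (Suc k))"
        using growth[OF \<omega>, of "J k \<omega>"] by (simp only: inverse_eq_divide)
      then show ?thesis using c by (simp add: pos_le_divide_eq mult.commute)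
    qed
    have "(\<lambda>k. (dist (h (J k \<omega>)) (W \<omega>))\<^sup>2) \<longlonglongrightarrow> 0"
    proof (rule tendsto_sandwich[OF _ _ tendsto_const])
      show "(\<lambda>k. 1 / c * inverse (real (Suc k))) \<longlonglongrightarrow> 0"
        using tendsto_mult_left[OF LIMSEQ_inverse_real_of_nat, of "1 / c"] by simp
    qed (use bound in \<open>auto intro!: always_eventually\<close>)
    then have "(\<lambda>k. sqrt ((dist (h (J k \<omega>)) (W \<omega>))\<^sup>2)) \<longlonglongrightarrow> sqrt 0" by (rule tendsto_real_sqrt)
    then have "(\<lambda>k. dist (h (J k \<omega>)) (W \<omega>)) \<longlonglongrightarrow> 0" by simp
    then show "(\<lambda>k. h (J k \<omega>)) \<longlonglongrightarrow> W \<omega>" by (rule iffD2[OF tendsto_dist_iff])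
  qed
qed

text \<open>The solution is given separately for each data set, so its measurability needs proof.
  Continuity of the objective lets a countable dense set of candidates approach the minimum, and
  quadratic growth identifies the local model in the limit.\<close>

lemma fed_solution_measurable:
  fixes loss :: "'v::euclidean_space \<Rightarrow> 'z \<Rightarrow> real"
  assumes p: "\<And>i. i \<in> {1..m} \<Longrightarrow> p i > 0" and lam: "lam > 0" and mu: "\<mu> > 0"
    and meas: "\<And>v i j. i \<in> {1..m} \<Longrightarrow> j \<in> {1..n i} \<Longrightarrow> (\<lambda>\<omega>. loss v (Z i j \<omega>)) \<in> borel_measurable M"
    and diff: "\<And>v i j \<omega>. i \<in> {1..m} \<Longrightarrow> j \<in> {1..n i} \<Longrightarrow> \<omega> \<in> space M \<Longrightarrow>
      (\<lambda>v. loss v (Z i j \<omega>)) differentiable (at v)"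
    and convex: "\<And>i \<omega>. i \<in> {1..m} \<Longrightarrow> \<omega> \<in> space M \<Longrightarrow>
      strongly_convex \<mu> (emp_loss loss (n i) (\<lambda>j. Z i j \<omega>))"
    and sol: "\<And>\<omega>. \<omega> \<in> space M \<Longrightarrow>
      fed_solution loss m p n lam (\<lambda>i j. Z i j \<omega>) (wg \<omega>) (wl \<omega>)"
    and i: "i \<in> {1..m}"
  shows "(\<lambda>\<omega>. wl \<omega> i) \<in> borel_measurable M"
proof -
  obtain Q :: "'v set" where Q: "countable Q" "Q \<subseteq> UNIV" "UNIV \<subseteq> closure Q"
    by (rule separable)
  \<comment> \<open>Extensional functions on the finite set of clients keep the candidate set
    countable; values at other indices do not enter the objective.\<close>
  define X where "X = Q \<times> (PiE {1..m} (\<lambda>_. Q))"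
  have X: "countable X" unfolding X_def using Q by (intro countable_SIGMA countable_PiE) auto
  have "Q \<noteq> {}" using Q by auto
  then have ne: "X \<noteq> {}" unfolding X_def by (simp add: PiE_eq_empty_iff)
  define obj where "obj \<omega> = fed_objective loss m p n lam (\<lambda>i j. Z i j \<omega>)" for \<omega>
  let ?e = "from_nat_into X"
  show ?thesis
  proof (rule measurable_minimizer)
    show "(\<lambda>\<omega>. obj \<omega> (?e k)) \<in> borel_measurable M" for k
      unfolding obj_def fed_objective_def emp_loss_def case_prod_beta
      by (intro borel_measurable_sum borel_measurable_times borel_measurable_add borel_measurable_const meas)
    show "p i * (\<mu> / 2) > 0" using p[OF i] mu by simp
    fix \<omega> assume \<omega>: "\<omega> \<in> space M"
    have gd: "GDERIV (emp_loss loss (n k) (\<lambda>j. Z k j \<omega>)) v :>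
        grad (emp_loss loss (n k) (\<lambda>j. Z k j \<omega>)) v" if "k \<in> {1..m}" for k v
    proof -
      have *: "GDERIV (emp_loss loss (n k) (\<lambda>j. Z k j \<omega>)) v :>
          (1 / real (n k)) *\<^sub>R (\<Sum>j=1..n k. grad (\<lambda>v. loss v (Z k j \<omega>)) v)"
        using diff[OF that _ \<omega>] by (rule GDERIV_emp_loss)
      show ?thesis using * by (simp only: grad_eqI[OF *])
    qed
    show "obj \<omega> (wg \<omega>, wl \<omega>) + p i * (\<mu> / 2) * (dist (snd (?e k) i) (wl \<omega> i))\<^sup>2 \<le> obj \<omega> (?e k)" for k
    proof -
      have "obj \<omega> (fst (?e k), snd (?e k)) \<ge> obj \<omega> (wg \<omega>, wl \<omega>) +
          (\<Sum>j=1..m. p j * (\<mu> / 2 * (norm (snd (?e k) j - wl \<omega> j))\<^sup>2))"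
        unfolding obj_def
      proof (rule fed_objective_quadratic_growth)
        show "grad (emp_loss loss (n j) (\<lambda>l. Z j l \<omega>)) (wl \<omega> j) = lam *\<^sub>R (wg \<omega> - wl \<omega> j)"
          if "j \<in> {1..m}" for j
          using fed_solution_local_stationary[OF sol[OF \<omega>] that p[OF that] gd[OF that]] .
        show "(\<Sum>j=1..m. p j *\<^sub>R (wg \<omega> - wl \<omega> j)) = 0"
          using fed_solution_global_stationary[OF sol[OF \<omega>]] lam by simp
      qed (use p lam convex \<omega> in \<open>auto intro: less_imp_le\<close>)
      moreover have "p i * (\<mu> / 2 * (norm (snd (?e k) i - wl \<omega> i))\<^sup>2) \<le>
          (\<Sum>j=1..m. p j * (\<mu> / 2 * (norm (snd (?e k) j - wl \<omega> j))\<^sup>2))"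
        using p mu i by (intro member_le_sum) (auto intro!: mult_nonneg_nonneg simp: less_imp_le)
      ultimately show ?thesis by (simp add: dist_norm)
    qed
    fix e :: real assume e: "e > 0"
    have "\<exists>s. (\<forall>k. s k \<in> Q) \<and> s \<longlonglongrightarrow> v" for v
      using subsetD[OF Q(3) UNIV_I] unfolding closure_sequential .
    then obtain s where s: "\<And>v k. s v k \<in> Q" "\<And>v. s v \<longlonglongrightarrow> v" by metis
    define y where "y k = (s (wg \<omega>) k, \<lambda>j\<in>{1..m}. s (wl \<omega> j) k)" for k
    have yX: "y k \<in> X" for k using s by (auto simp: X_def y_def)
    have "(\<lambda>k. obj \<omega> (y k)) \<longlonglongrightarrow> obj \<omega> (wg \<omega>, wl \<omega>)"
    proof -
      have "(\<lambda>k. emp_loss loss (n j) (\<lambda>l. Z j l \<omega>) (s (wl \<omega> j) k)) \<longlonglongrightarrow> emp_loss loss (n j) (\<lambda>l. Z j l \<omega>) (wl \<omega> j)"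
        if "j \<in> {1..m}" for j
      proof (rule isCont_tendsto_compose[OF _ s(2)])
        show "isCont (emp_loss loss (n j) (\<lambda>l. Z j l \<omega>)) (wl \<omega> j)"
          using gd[OF that] unfolding gderiv_def by (rule has_derivative_continuous)
      qed
      then show ?thesis
        unfolding obj_def fed_objective_def y_def prod.case
        by (intro tendsto_sum tendsto_mult tendsto_add tendsto_power tendsto_norm tendsto_diff tendsto_const s(2))
          (simp_all add: s(2))
    qed
    then have "eventually (\<lambda>k. obj \<omega> (y k) < obj \<omega> (wg \<omega>, wl \<omega>) + e) sequentially"
      using e by (intro order_tendstoD) auto
    then obtain k where "obj \<omega> (y k) < obj \<omega> (wg \<omega>, wl \<omega>) + e"
      by (auto simp: eventually_sequentially)
    moreover obtain l where "?e l = y k" using from_nat_into_surj[OF X yX] by blast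
    ultimately show "\<exists>k. obj \<omega> (?e k) < obj \<omega> (wg \<omega>, wl \<omega>) + e" by metis
  qed
qed

subsection \<open>Expected error\<close>

text \<open>An arbitrary index set \<open>I\<close> covers both the block of one client and the full
  sample. Mean zero and the variance bound are carried from \<open>D i\<close> to the sample by the
  image measure.\<close>

lemma client_gradient_second_moment:
  fixes loss :: "'v::euclidean_space \<Rightarrow> 'z \<Rightarrow> real"
  assumes data: "client_data M Zs D m n Z"
    and diff: "\<And>w z. z \<in> space Zs \<Longrightarrow> (\<lambda>v. loss v z) differentiable (at w)"
    and truth: "\<And>i. i \<in> {1..m} \<Longrightarrow> ground_truth loss (D i) (wstar i)"
    and lip: "\<And>x y z. z \<in> space Zs \<Longrightarrow>
      norm (grad (\<lambda>v. loss v z) x - grad (\<lambda>v. loss v z) y) \<le> L * norm (x - y)"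
    and var: "\<And>i. i \<in> {1..m} \<Longrightarrow>
      integrable (D i) (\<lambda>z. (norm (grad (\<lambda>v. loss v z) (wstar i)))\<^sup>2) \<and>
      (\<integral>z. (norm (grad (\<lambda>v. loss v z) (wstar i)))\<^sup>2 \<partial>D i) \<le> \<rho>\<^sup>2"
    and I: "I \<subseteq> (SIGMA i:{1..m}. {1..n i})"
  shows "integrable M (\<lambda>\<omega>. (norm (\<Sum>(i, j)\<in>I. grad (\<lambda>v. loss v (Z i j \<omega>)) (wstar i)))\<^sup>2)"
    and "(\<integral>\<omega>. (norm (\<Sum>(i, j)\<in>I. grad (\<lambda>v. loss v (Z i j \<omega>)) (wstar i)))\<^sup>2 \<partial>M) \<le> real (card I) * \<rho>\<^sup>2"
proof -
  interpret prob_space M using data by (simp add: client_data_def)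
  let ?I = "SIGMA i:{1..m}. {1..n i}"
  let ?g = "\<lambda>i z. grad (\<lambda>v. loss v z) (wstar i)"
  let ?X = "\<lambda>k \<omega>. ?g (fst k) (Z (fst k) (snd k) \<omega>)"
  have indep: "indep_vars (\<lambda>_. Zs) (\<lambda>(i, j). Z i j) ?I"
    and law: "\<And>i j. i \<in> {1..m} \<Longrightarrow> j \<in> {1..n i} \<Longrightarrow> distr M Zs (Z i j) = D i"
    using data by (auto simp: client_data_def)
  have Z: "Z (fst k) (snd k) \<in> measurable M Zs" if "k \<in> ?I" for k
    using indep that by (auto simp: indep_vars_def case_prod_beta)
  have D: "D (fst k) = distr M Zs (Z (fst k) (snd k))" if "k \<in> ?I" for k
    using law that by auto
  have g: "?g (fst k) \<in> borel_measurable Zs" if k: "k \<in> ?I" for k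
  proof (rule grad_measurable)
    \<comment> \<open>Integrability for a law on \<open>Zs\<close> includes measurability of the
      loss in the data point.\<close>
    have "integrable (D (fst k)) (loss v)" for v
      using truth k by (auto simp: ground_truth_def)
    then show "loss v \<in> borel_measurable Zs" for v
      unfolding D[OF k] by (auto dest: borel_measurable_integrable)
  qed (rule diff)
  have prob: "prob_space (D (fst k))" if "k \<in> ?I" for k
    unfolding D[OF that] by (rule prob_space_distr[OF Z[OF that]])
  have zero: "expectation (?X k) = 0" if k: "k \<in> ?I" for k
  proof -
    have "(\<integral>z. ?g (fst k) z \<partial>D (fst k)) = 0"
    proof (rule ground_truth_grad_mean_zero[OF prob[OF k]])
      show "ground_truth loss (D (fst k)) (wstar (fst k))" using truth k by auto
      show "integrable (D (fst k)) (\<lambda>z. (norm (?g (fst k) z))\<^sup>2)" using var k by auto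
      show "(\<lambda>v. loss v z) differentiable at v" if "z \<in> space (D (fst k))" for z v
        using that diff by (simp add: D[OF k])
      show "norm (grad (\<lambda>v. loss v z) x - grad (\<lambda>v. loss v z) y) \<le> L * norm (x - y)"
        if "z \<in> space (D (fst k))" for x y z
        using that lip by (simp add: D[OF k])
    qed
    then show ?thesis unfolding D[OF k] by (subst (asm) integral_distr[OF Z[OF k] g[OF k]])
  qed
  have meas_sq: "(\<lambda>z. (norm (?g (fst k) z))\<^sup>2) \<in> borel_measurable Zs" if "k \<in> ?I" for k
    using g[OF that] by measurable
  have var': "integrable (D (fst k)) (\<lambda>z. (norm (?g (fst k) z))\<^sup>2)"
    "(\<integral>z. (norm (?g (fst k) z))\<^sup>2 \<partial>D (fst k)) \<le> \<rho>\<^sup>2" if "k \<in> ?I" for k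
    using var that by auto
  have sq: "integrable M (\<lambda>\<omega>. (norm (?X k \<omega>))\<^sup>2)" "expectation (\<lambda>\<omega>. (norm (?X k \<omega>))\<^sup>2) \<le> \<rho>\<^sup>2"
    if k: "k \<in> ?I" for k
    using var'[OF k] unfolding D[OF k]
    by (simp_all add: integrable_distr_eq[OF Z[OF k] meas_sq[OF k]] integral_distr[OF Z[OF k] meas_sq[OF k]])
  have fin: "finite I" using I by (rule finite_subset) auto
  have "indep_vars (\<lambda>_. borel) ?X ?I"
  proof (rule indep_vars_compose2[where M' = "\<lambda>_. Zs" and X = "\<lambda>k. Z (fst k) (snd k)" and Y = "\<lambda>k. ?g (fst k)"])
    show "indep_vars (\<lambda>_. Zs) (\<lambda>k. Z (fst k) (snd k)) ?I" using indep by (simp only: case_prod_unfold)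
  qed (rule g)
  then have indep': "indep_vars (\<lambda>_. borel) ?X I" using I by (rule indep_vars_subset)
  note * = indep_mean_zero_second_moment[OF fin indep' sq(1) zero, OF subsetD[OF I] subsetD[OF I]]
  show "integrable M (\<lambda>\<omega>. (norm (\<Sum>(i, j)\<in>I. ?g i (Z i j \<omega>)))\<^sup>2)"
    using *(1) by (simp add: case_prod_beta)
  have "(\<integral>\<omega>. (norm (\<Sum>(i, j)\<in>I. ?g i (Z i j \<omega>)))\<^sup>2 \<partial>M) = (\<Sum>k\<in>I. expectation (\<lambda>\<omega>. (norm (?X k \<omega>))\<^sup>2))"
    using *(2) by (simp add: case_prod_beta)
  also have "\<dots> \<le> (\<Sum>k\<in>I. \<rho>\<^sup>2)" using sq(2) I by (intro sum_mono) auto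
  finally show "(\<integral>\<omega>. (norm (\<Sum>(i, j)\<in>I. ?g i (Z i j \<omega>)))\<^sup>2 \<partial>M) \<le> real (card I) * \<rho>\<^sup>2" by simp
qed

text \<open>The common shape of the two pointwise estimates: own noise, total noise, and averaged
  gradient. Integrability of \<open>f\<close> follows by domination.\<close>

lemma (in prob_space) expectation_affine_bound:
  fixes A :: "'i \<Rightarrow> 'a \<Rightarrow> real"
  assumes f: "f \<in> borel_measurable M" "\<And>\<omega>. f \<omega> \<ge> 0"
    and A: "\<And>k. k \<in> I \<Longrightarrow> integrable M (A k)" "\<And>k. k \<in> I \<Longrightarrow> expectation (A k) \<le> s"
    and B: "integrable M B" "expectation B \<le> r"
    and c: "c1 \<ge> 0" "c2 \<ge> 0" "c3 \<ge> 0" and i: "i \<in> I"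
    and le: "\<And>\<omega>. \<omega> \<in> space M \<Longrightarrow> f \<omega> \<le> c0 + c1 * A i \<omega> + c2 * (\<Sum>k\<in>I. A k \<omega>) + c3 * B \<omega>"
  shows "integrable M f" "expectation f \<le> c0 + c1 * s + c2 * (real (card I) * s) + c3 * r"
proof -
  let ?g = "\<lambda>\<omega>. c0 + c1 * A i \<omega> + c2 * (\<Sum>k\<in>I. A k \<omega>) + c3 * B \<omega>"
  have g: "integrable M ?g" using A B i by (intro Bochner_Integration.integrable_add integrable_mult_right Bochner_Integration.integrable_sum) auto
  show int: "integrable M f"
  proof (rule Bochner_Integration.integrable_bound[OF g])
    show "AE \<omega> in M. norm (f \<omega>) \<le> norm (?g \<omega>)"
      using le f(2) by (intro AE_I2) (smt (verit) real_norm_def)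
  qed (rule f(1))
  have "expectation f \<le> expectation ?g" by (rule integral_mono[OF int g le])
  also have "expectation ?g = c0 + c1 * expectation (A i) + c2 * (\<Sum>k\<in>I. expectation (A k)) + c3 * expectation B"
    using A(1) B(1) i by (simp add: prob_space)
  also have "\<dots> \<le> c0 + c1 * s + c2 * (\<Sum>k\<in>I. s) + c3 * r"
    using A(2) B(2) i c by (intro add_mono mult_left_mono sum_mono order_refl) auto
  finally show "expectation f \<le> c0 + c1 * s + c2 * (real (card I) * s) + c3 * r" by simp
qed

section \<open>Arithmetic that turns the error bounds into the stated rates\<close>

lemma rate_weak_coupling:
  fixes \<mu> \<rho> R lam C2 C4 n' :: real
  assumes mu: "\<mu> > 0" and lam: "lam > 0" and n: "n' > 0"
    and R: "R > 1 / sqrt n'" and lam_le: "lam \<le> \<rho>\<^sup>2 / (n' * \<mu> * R\<^sup>2)"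
    and C2: "C2 \<ge> ((1 + sqrt 3) * \<rho> / \<mu>)\<^sup>2"
    and C4: "C4 \<ge> (\<rho> * (1 + sqrt (4 * C2 + 5)) / \<mu>)\<^sup>2"
  shows "1 / \<mu>\<^sup>2 * (\<rho>\<^sup>2 / n') + lam / \<mu> * (R\<^sup>2 + \<rho>\<^sup>2 / n' / \<mu>\<^sup>2 + lam * R\<^sup>2 / (2 * \<mu>))
    \<le> C4 * min (R\<^sup>2) (1 / n')"
proof -
  define q where "q = (\<rho> / \<mu>)\<^sup>2"
  have q: "q \<ge> 0" by (simp add: q_def)
  have R0: "R > 0" using R n by (smt (verit) divide_pos_pos real_sqrt_gt_zero)
  have "(1 / sqrt n')\<^sup>2 < R\<^sup>2" using R n by (intro power_strict_mono) auto
  then have R2: "1 / n' < R\<^sup>2" using n by (simp add: power_divide)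
  \<comment> \<open>In units of \<open>q\<close>, the upper bound on \<open>lam\<close> controls the
    coupling cost; since the squared radius exceeds \<open>1 / n'\<close>, it also bounds
    \<open>lam / \<mu>\<close> by \<open>q\<close> itself.\<close>
  have lam_R: "lam / \<mu> * R\<^sup>2 \<le> q / n'"
    using lam_le mu n R0 by (simp add: q_def field_simps power2_eq_square)
  have lam_q: "lam / \<mu> \<le> q"
  proof -
    have "lam / \<mu> * (1 / n') \<le> lam / \<mu> * R\<^sup>2" using R2 lam mu by (intro mult_left_mono) auto
    also note lam_R
    finally show ?thesis using n by (simp add: field_simps)
  qed
  have "q \<le> C2"
  proof -
    have "1 \<le> (1 + sqrt 3)\<^sup>2" by (intro one_le_power) simp
    then have "1 * q \<le> (1 + sqrt 3)\<^sup>2 * q" using q by (intro mult_right_mono) auto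
    also have "\<dots> = ((1 + sqrt 3) * \<rho> / \<mu>)\<^sup>2" by (simp add: q_def power_mult_distrib power_divide)
    finally show ?thesis using C2 by simp
  qed
  have "1 / \<mu>\<^sup>2 * (\<rho>\<^sup>2 / n') + lam / \<mu> * (R\<^sup>2 + \<rho>\<^sup>2 / n' / \<mu>\<^sup>2 + lam * R\<^sup>2 / (2 * \<mu>))
      = q / n' + lam / \<mu> * R\<^sup>2 + lam / \<mu> * (q / n') + lam / \<mu> * (lam / \<mu> * R\<^sup>2) / 2"
    using mu by (simp add: q_def field_simps power2_eq_square)
  also have "\<dots> \<le> q / n' + q / n' + q * (q / n') + q * (q / n') / 2"
    using lam_R lam_q lam mu n q
    by (intro add_mono divide_right_mono mult_mono order_refl) auto
  also have "\<dots> = q * (2 + 3 / 2 * q) / n'" using n by (simp add: field_simps)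
  \<comment> \<open>As \<open>C2\<close> dominates \<open>q\<close>, the factor 2 + 3q/2 fits under
    \<open>4 * C2 + 6\<close>, which is part of the expanded square.\<close>
  also have "\<dots> \<le> q * (1 + sqrt (4 * C2 + 5))\<^sup>2 / n'"
  proof -
    have "2 + 3 / 2 * q \<le> 1 + (4 * C2 + 5)" using \<open>q \<le> C2\<close> q by simp
    also have "\<dots> \<le> (1 + sqrt (4 * C2 + 5))\<^sup>2" using \<open>q \<le> C2\<close> q by (simp add: power2_sum)
    finally show ?thesis using q n by (intro divide_right_mono mult_left_mono) auto
  qed
  also have "\<dots> = (\<rho> * (1 + sqrt (4 * C2 + 5)) / \<mu>)\<^sup>2 / n'"
    by (simp add: q_def power_mult_distrib power_divide)
  also have "\<dots> \<le> C4 / n'" using C4 n by (intro divide_right_mono) auto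
  also have "\<dots> = C4 * min (R\<^sup>2) (1 / n')" using R2 by simp
  finally show ?thesis .
qed

text \<open>Here \<open>s\<close> bounds the noise of one client and \<open>r\<close> that of the
  average. The ratio in the lower bound for \<Lambda> is at least 1, so its square still carries a
  full factor \<open>s / T\<close>; taking 5 * \<mu> and 2 * L from the maximum gives the two
  claims.\<close>

lemma coupling_dominates_variance:
  fixes \<mu> \<rho> R L s r \<Lambda> :: real
  assumes mu: "\<mu> > 0" and L: "L \<ge> 0" and r: "0 \<le> r" "r \<le> s" "r = 0 \<Longrightarrow> s = 0"
    and La: "max (2 * (L / \<mu>)) 5 * \<mu> * ((2 * L\<^sup>2 * R\<^sup>2 + s) / (L\<^sup>2 * R\<^sup>2 + r)) \<le> \<Lambda>"
  shows "25 * \<mu>\<^sup>2 * s \<le> (L\<^sup>2 * R\<^sup>2 + r) * \<Lambda>\<^sup>2" "4 * L\<^sup>2 * s \<le> (L\<^sup>2 * R\<^sup>2 + r) * \<Lambda>\<^sup>2"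
proof -
  define T where "T = L\<^sup>2 * R\<^sup>2 + r"
  define Q where "Q = (2 * L\<^sup>2 * R\<^sup>2 + s) / T"
  have LR: "L\<^sup>2 * R\<^sup>2 \<ge> 0" by simp
  have T: "T \<ge> 0" using LR r by (simp add: T_def)
  have main: "c\<^sup>2 * s \<le> T * \<Lambda>\<^sup>2" if c: "c \<ge> 0" "c * Q \<le> \<Lambda>" for c
  \<comment> \<open>Division by zero makes \<open>Q\<close> equal to 0 here, so the bound on
    \<Lambda> says nothing; but then \<open>r\<close> and hence \<open>s\<close> vanish.\<close>
  proof (cases "T = 0")
    case True
    then have "r = 0" using LR r unfolding T_def by linarith
    then show ?thesis using r T by simp
  next
    case False
    with T have T: "T > 0" by simp
    have QT: "Q * T = 2 * L\<^sup>2 * R\<^sup>2 + s" using T by (simp add: Q_def)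
    have "l + r \<le> 2 * l + s" if "l \<ge> 0" for l :: real
      using that r(2) by simp
    from this[OF LR] have "1 * T \<le> Q * T" unfolding QT by (simp add: T_def mult.assoc)
    then have Q: "Q \<ge> 1" using T by (simp only: mult_le_cancel_right_pos)
    have "c\<^sup>2 * s \<le> c\<^sup>2 * (Q * T)" unfolding QT using LR by (intro mult_left_mono) auto
    also have "\<dots> \<le> c\<^sup>2 * (Q * (Q * T))"
      using Q T mult_right_mono[OF Q, of "Q * T"] by (intro mult_left_mono) auto
    also have "\<dots> = T * (c * Q)\<^sup>2" by (simp add: power2_eq_square ac_simps)
    also have "\<dots> \<le> T * \<Lambda>\<^sup>2" using c Q T by (intro mult_left_mono power_mono) auto
    finally show ?thesis .
  qed
  have "Q \<ge> 0" unfolding Q_def using T LR r by (intro divide_nonneg_nonneg) auto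
  then have "5 * \<mu> * Q \<le> max (2 * (L / \<mu>)) 5 * \<mu> * Q" "2 * (L / \<mu>) * \<mu> * Q \<le> max (2 * (L / \<mu>)) 5 * \<mu> * Q"
    using mu by (intro mult_right_mono; simp)+
  then have "(5 * \<mu>) * Q \<le> \<Lambda>" "(2 * L) * Q \<le> \<Lambda>"
    using La mu unfolding Q_def T_def by simp_all
  from main[OF _ this(1)] main[OF _ this(2)]
  show "25 * \<mu>\<^sup>2 * s \<le> (L\<^sup>2 * R\<^sup>2 + r) * \<Lambda>\<^sup>2" "4 * L\<^sup>2 * s \<le> (L\<^sup>2 * R\<^sup>2 + r) * \<Lambda>\<^sup>2"
    using mu L by (simp_all add: T_def power_mult_distrib)
qed

text \<open>In units of the scaled radius \<open>x\<close> and the scaled averaged noise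
  \<open>y\<close>, the left side is at most 25 x + 21 y, well inside the stated constants.\<close>

lemma rate_strong_coupling:
  fixes \<mu> \<rho> R L s r \<Lambda> :: real
  assumes mu: "0 < \<mu>" "\<mu> \<le> L" and La: "\<Lambda> > 0" and r: "0 \<le> r"
    and "25 * \<mu>\<^sup>2 * s \<le> (L\<^sup>2 * R\<^sup>2 + r) * \<Lambda>\<^sup>2" "4 * L\<^sup>2 * s \<le> (L\<^sup>2 * R\<^sup>2 + r) * \<Lambda>\<^sup>2"
  shows "4 * R\<^sup>2 + 16 / \<mu>\<^sup>2 * (L\<^sup>2 * R\<^sup>2) + 4 / \<Lambda>\<^sup>2 * s + 16 / \<mu>\<^sup>2 * (L / \<Lambda>)\<^sup>2 * s + 16 / \<mu>\<^sup>2 * r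
    \<le> 192 / \<mu>\<^sup>2 * r + 198 * (L / \<mu>)\<^sup>2 * R\<^sup>2"
proof -
  define x where "x = (L / \<mu>)\<^sup>2 * R\<^sup>2"
  define y where "y = r / \<mu>\<^sup>2"
  have xy: "x \<ge> 0" "y \<ge> 0" using r by (simp_all add: x_def y_def)
  have T: "L\<^sup>2 * R\<^sup>2 + r = \<mu>\<^sup>2 * (x + y)"
    using mu by (simp add: x_def y_def field_simps)
  have "\<mu>\<^sup>2 * (25 * s) \<le> \<mu>\<^sup>2 * ((x + y) * \<Lambda>\<^sup>2)" using assms(5) unfolding T by (simp add: ac_simps)
  then have "25 * s \<le> (x + y) * \<Lambda>\<^sup>2" using mu by simp
  then have 1: "4 / \<Lambda>\<^sup>2 * s \<le> x + y" using La r
    by (simp add: pos_divide_le_eq) (smt (verit) La zero_less_power mult_nonneg_nonneg xy)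
  have 2: "16 / \<mu>\<^sup>2 * (L / \<Lambda>)\<^sup>2 * s \<le> 4 * (x + y)"
  proof -
    have "16 / \<mu>\<^sup>2 * (L / \<Lambda>)\<^sup>2 * s = 4 / (\<mu>\<^sup>2 * \<Lambda>\<^sup>2) * (4 * L\<^sup>2 * s)"
      by (simp add: power_divide)
    also have "\<dots> \<le> 4 / (\<mu>\<^sup>2 * \<Lambda>\<^sup>2) * (\<mu>\<^sup>2 * (x + y) * \<Lambda>\<^sup>2)"
      using assms(6) unfolding T by (intro mult_left_mono) auto
    also have "\<dots> = 4 * (x + y)" using mu La by simp
    finally show ?thesis .
  qed
  have 3: "R\<^sup>2 \<le> x"
  proof -
    have "1 \<le> (L / \<mu>)\<^sup>2" using mu by (intro one_le_power) simp
    then show ?thesis unfolding x_def using mult_right_mono[of 1 "(L / \<mu>)\<^sup>2" "R\<^sup>2"] by simp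
  qed
  have eqs: "16 / \<mu>\<^sup>2 * (L\<^sup>2 * R\<^sup>2) = 16 * x" "16 / \<mu>\<^sup>2 * r = 16 * y"
    "192 / \<mu>\<^sup>2 * r = 192 * y" "198 * (L / \<mu>)\<^sup>2 * R\<^sup>2 = 198 * x"
    by (simp_all add: x_def y_def power_divide)
  have "4 * z + 16 * x + a + b + 16 * y \<le> 192 * y + 198 * x"
    if "a \<le> x + y" "b \<le> 4 * (x + y)" "z \<le> x" for a b z
    using that xy by simp
  from this[OF 1 2 3] show ?thesis unfolding eqs .
qed

section \<open>From estimates for each data set to the expected local error\<close>

theorem corollary1:
  fixes M :: "'w measure"
    and Zs :: "'z measure"
    and D :: "nat \<Rightarrow> 'z measure"
    and Z :: "nat \<Rightarrow> nat \<Rightarrow> 'w \<Rightarrow> 'z"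
    and loss :: "real ^ 'd \<Rightarrow> 'z \<Rightarrow> real"
    and wstar :: "nat \<Rightarrow> real ^ 'd"
    and wg :: "'w \<Rightarrow> real ^ 'd"
    and wl :: "'w \<Rightarrow> nat \<Rightarrow> real ^ 'd"
    and m n N :: nat
    and p :: "nat \<Rightarrow> real"
    and L \<mu> \<rho> R lam \<kappa> C2 C3 C4 :: real
  assumes m: "m \<ge> 1" and n: "n \<ge> 1" and N: "N = m * n"
    and p: "\<And>i. i \<in> {1..m} \<Longrightarrow> p i = 1 / real m"
    and data: "client_data M Zs D m (\<lambda>_. n) Z"
    and diff: "\<And>w z. z \<in> space Zs \<Longrightarrow> (\<lambda>v. loss v z) differentiable (at w)"
    and truth: "\<And>i. i \<in> {1..m} \<Longrightarrow> ground_truth loss (D i) (wstar i)"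
    and A1: "\<And>x y z. z \<in> space Zs \<Longrightarrow>
      norm (grad (\<lambda>v. loss v z) x - grad (\<lambda>v. loss v z) y) \<le> L * norm (x - y)"
    and mu: "\<mu> > 0"
    and A2: "\<And>i \<omega>. i \<in> {1..m} \<Longrightarrow> \<omega> \<in> space M \<Longrightarrow>
      strongly_convex \<mu> (emp_loss loss n (\<lambda>j. Z i j \<omega>))"
    and rho: "\<rho> \<ge> 0"
    and A3: "\<And>i. i \<in> {1..m} \<Longrightarrow>
      integrable (D i) (\<lambda>z. (norm (grad (\<lambda>v. loss v z) (wstar i)))\<^sup>2) \<and>
      (\<integral>z. (norm (grad (\<lambda>v. loss v z) (wstar i)))\<^sup>2 \<partial>D i) \<le> \<rho>\<^sup>2"
    and R: "R \<ge> 0"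
    and wstar: "wstar \<in> param_space m p R"
    and lam: "lam > 0"
    and kappa: "\<kappa> = L / \<mu>"
    and lam_small_R: "R \<le> 1 / sqrt (real n) \<Longrightarrow>
      lam \<ge> max (64 * \<kappa>\<^sup>2 * L)
                (max (2 * \<kappa>) 5 * \<mu> *
                  ((2 * L\<^sup>2 * R\<^sup>2 + \<rho>\<^sup>2 / real n) / (L\<^sup>2 * R\<^sup>2 + \<rho>\<^sup>2 / real N))) - \<mu>"
    and lam_large_R: "R > 1 / sqrt (real n) \<Longrightarrow> lam \<le> \<rho>\<^sup>2 / (real n * \<mu> * R\<^sup>2)"
    and sol: "\<And>\<omega>. \<omega> \<in> space M \<Longrightarrow>
      fed_solution loss m p (\<lambda>_. n) lam (\<lambda>i j. Z i j \<omega>) (wg \<omega>) (wl \<omega>)"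
    and C2: "C2 = max (((1 + sqrt 3) * \<rho> / \<mu>)\<^sup>2) (32 * L\<^sup>2 / \<mu>\<^sup>2)"
    and C3: "C3 = 192 * \<rho>\<^sup>2 / \<mu>\<^sup>2"
    and C4: "C4 = max ((\<rho> * (1 + sqrt (4 * C2 + 5)) / \<mu>)\<^sup>2) (198 * \<kappa>\<^sup>2)"
  shows "\<forall>i\<in>{1..m}.
    integrable M (\<lambda>\<omega>. (norm (wl \<omega> i - wstar i))\<^sup>2) \<and>
    (\<integral>\<omega>. (norm (wl \<omega> i - wstar i))\<^sup>2 \<partial>M) \<le> C3 * (1 / real N) + C4 * min (R\<^sup>2) (1 / real n)"
proof -
  interpret prob_space M using data by (simp add: client_data_def)
  let ?f = "\<lambda>\<omega> i. emp_loss loss n (\<lambda>j. Z i j \<omega>)"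
  let ?g = "\<lambda>\<omega> (i, j). grad (\<lambda>v. loss v (Z i j \<omega>)) (wstar i)"
  define wb where "wb = (\<Sum>k=1..m. p k *\<^sub>R wstar k)"
  define A where "A i \<omega> = (norm (grad (?f \<omega> i) (wstar i)))\<^sup>2" for i \<omega>
  define B where "B \<omega> = (norm (\<Sum>i=1..m. grad (?f \<omega> i) (wstar i)) / real m)\<^sup>2" for \<omega>
  have m0: "real m > 0" and n0: "real n > 0" using m n by auto
  have Z: "Z i j \<in> measurable M Zs" if "i \<in> {1..m}" "j \<in> {1..n}" for i j
    using data that by (auto simp: client_data_def indep_vars_def)
  have Zs: "Z i j \<omega> \<in> space Zs" if "i \<in> {1..m}" "j \<in> {1..n}" "\<omega> \<in> space M" for i j \<omega>
    using measurable_space[OF Z] that by auto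
  have loss_meas: "(\<lambda>\<omega>. loss v (Z i j \<omega>)) \<in> borel_measurable M" if ij: "i \<in> {1..m}" "j \<in> {1..n}" for v i j
  proof (rule measurable_compose[OF Z[OF ij]])
    have "D i = distr M Zs (Z i j)" using data ij by (auto simp: client_data_def)
    moreover have "integrable (D i) (loss v)" using truth[OF ij(1)] by (simp add: ground_truth_def)
    ultimately show "loss v \<in> borel_measurable Zs" by (auto dest: borel_measurable_integrable)
  qed
  have gd: "GDERIV (?f \<omega> i) w :> (1 / real n) *\<^sub>R (\<Sum>j=1..n. grad (\<lambda>v. loss v (Z i j \<omega>)) w)"
    if "i \<in> {1..m}" "\<omega> \<in> space M" for i \<omega> w
    using Zs that by (intro GDERIV_emp_loss diff)
  note grad_f = grad_eqI[OF gd]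
  have grad_lip: "norm (grad (?f \<omega> i) x - grad (?f \<omega> i) y) \<le> L * norm (x - y)"
    if "i \<in> {1..m}" "\<omega> \<in> space M" for i \<omega> x y
    using Zs that n by (intro grad_emp_loss_lipschitz diff A1)
  \<comment> \<open>Smoothness and convexity of an empirical loss meet at an actual sample point;
    one suffices to compare the two constants.\<close>
  obtain \<omega>0 where \<omega>0: "\<omega>0 \<in> space M" using not_empty by blast
  have "1 \<in> {1..m}" using m by simp
  then have mu_le_L: "\<mu> \<le> L"
    using monotone_lipschitz_constants_le[OF strongly_convex_monotone[OF A2] grad_lip] \<omega>0 by blast
  have p_sum: "(\<Sum>k=1..m. p k *\<^sub>R x k) = (1 / real m) *\<^sub>R (\<Sum>k=1..m. x k)" for x :: "nat \<Rightarrow> real ^ 'd"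
    unfolding scaleR_right.sum using p by (intro sum.cong) auto

  have system: "coupled_system (\<lambda>i. grad (?f \<omega> i)) m \<mu> lam R wstar (wl \<omega>) (wg \<omega>) wb"
    if \<omega>: "\<omega> \<in> space M" for \<omega>
  proof
    show "\<mu> * (norm (x - y))\<^sup>2 \<le> (grad (?f \<omega> i) x - grad (?f \<omega> i) y) \<bullet> (x - y)" if "i \<in> {1..m}" for i x y
      by (rule strongly_convex_monotone[OF A2[OF that \<omega>]])
    show "grad (?f \<omega> i) (wl \<omega> i) = lam *\<^sub>R (wg \<omega> - wl \<omega> i)" if i: "i \<in> {1..m}" for i
    proof (rule fed_solution_local_stationary[OF sol[OF \<omega>] i])
      show "p i > 0" using p[OF i] m0 by simp
      show "GDERIV (?f \<omega> i) (wl \<omega> i) :> grad (?f \<omega> i) (wl \<omega> i)"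
        using gd[OF i \<omega>] by (simp only: grad_f[OF i \<omega>])
    qed
    show "(\<Sum>i=1..m. wg \<omega> - wl \<omega> i) = 0"
      using fed_solution_global_stationary[OF sol[OF \<omega>]] lam m0 unfolding p_sum by simp
    show "(\<Sum>i=1..m. wstar i - wb) = 0"
      unfolding wb_def p_sum using m0 by (simp add: sum_subtractf sum_constant_scaleR del: sum_constant)
    show "norm (wstar i - wb) \<le> R" if "i \<in> {1..m}" for i
      using wstar that R by (auto simp: param_space_def wb_def intro: power2_le_imp_le)
  qed (use m mu lam in auto)

  have wl_meas: "(\<lambda>\<omega>. (norm (wl \<omega> i - wstar i))\<^sup>2) \<in> borel_measurable M" if "i \<in> {1..m}" for i
  proof -
    have "(\<lambda>\<omega>. wl \<omega> i) \<in> borel_measurable M"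
      using p m0 Zs by (intro fed_solution_measurable[OF _ lam mu loss_meas diff A2 sol that]) auto
    then show ?thesis by measurable
  qed

  have second_moment: "integrable M (\<lambda>\<omega>. (norm (\<Sum>k\<in>I. ?g \<omega> k))\<^sup>2)"
    "expectation (\<lambda>\<omega>. (norm (\<Sum>k\<in>I. ?g \<omega> k))\<^sup>2) \<le> real (card I) * \<rho>\<^sup>2"
    if "I \<subseteq> (SIGMA i:{1..m}. {1..n})" for I
    by (rule client_gradient_second_moment[OF data diff truth A1 A3 that]; assumption)+
  have A: "integrable M (A i)" "expectation (A i) \<le> \<rho>\<^sup>2 / real n" if i: "i \<in> {1..m}" for i
  proof -
    \<comment> \<open>The block of one client has \<open>n\<close> terms and is scaled by
      \<open>1 / n\<close>, so the second moment gains the factor \<open>1 / n\<close>.\<close>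
    have sub: "{i} \<times> {1..n} \<subseteq> (SIGMA i:{1..m}. {1..n})" using i by auto
    have eq: "A i \<omega> = (norm (\<Sum>k\<in>{i} \<times> {1..n}. ?g \<omega> k))\<^sup>2 / (real n)\<^sup>2" if "\<omega> \<in> space M" for \<omega>
    proof -
      have "(\<Sum>k\<in>{i} \<times> {1..n}. ?g \<omega> k) = (\<Sum>j=1..n. grad (\<lambda>v. loss v (Z i j \<omega>)) (wstar i))"
        by (subst sum.cartesian_product[symmetric]) simp
      then show ?thesis by (simp add: A_def grad_f[OF i that] power_divide)
    qed
    show "integrable M (A i)"
      using second_moment(1)[OF sub] by (subst Bochner_Integration.integrable_cong[OF refl eq]) auto
    have "expectation (A i) = expectation (\<lambda>\<omega>. (norm (\<Sum>k\<in>{i} \<times> {1..n}. ?g \<omega> k))\<^sup>2) / (real n)\<^sup>2"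
      by (subst Bochner_Integration.integral_cong[OF refl eq]) auto
    also have "\<dots> \<le> (real (card ({i} \<times> {1..n})) * \<rho>\<^sup>2) / (real n)\<^sup>2"
      by (intro divide_right_mono second_moment(2)[OF sub]) auto
    finally show "expectation (A i) \<le> \<rho>\<^sup>2 / real n" using n0 by (simp add: power2_eq_square)
  qed
  have B: "integrable M B" "expectation B \<le> \<rho>\<^sup>2 / real N"
  proof -
    \<comment> \<open>The average of the client gradients is the mean over all \<open>N\<close>
      independent samples, hence the factor \<open>1 / N\<close>.\<close>
    let ?I = "SIGMA i:{1..m}. {1..n}"
    have eq: "B \<omega> = (norm (\<Sum>k\<in>?I. ?g \<omega> k))\<^sup>2 / (real N)\<^sup>2" if "\<omega> \<in> space M" for \<omega>
    proof -
      have "(\<Sum>i=1..m. grad (?f \<omega> i) (wstar i)) = (1 / real n) *\<^sub>R (\<Sum>k\<in>?I. ?g \<omega> k)"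
        unfolding sum.cartesian_product[symmetric] scaleR_right.sum
        by (intro sum.cong refl) (simp add: grad_f[OF _ that] scaleR_right.sum)
      then show ?thesis by (simp add: B_def N power_divide power_mult_distrib mult.commute)
    qed
    show "integrable M B"
      using second_moment(1)[of ?I] by (subst Bochner_Integration.integrable_cong[OF refl eq]) auto
    have "expectation B = expectation (\<lambda>\<omega>. (norm (\<Sum>k\<in>?I. ?g \<omega> k))\<^sup>2) / (real N)\<^sup>2"
      by (subst Bochner_Integration.integral_cong[OF refl eq]) auto
    also have "\<dots> \<le> (real (card ?I) * \<rho>\<^sup>2) / (real N)\<^sup>2"
      by (intro divide_right_mono second_moment(2)[of ?I]) auto
    finally show "expectation B \<le> \<rho>\<^sup>2 / real N" using n0 m0 by (simp add: N power2_eq_square)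
  qed

  show ?thesis
  proof
    fix i assume i: "i \<in> {1..m}"
    let ?e = "\<lambda>\<omega>. (norm (wl \<omega> i - wstar i))\<^sup>2"
    let ?bound = "C3 * (1 / real N) + C4 * min (R\<^sup>2) (1 / real n)"
    show "integrable M ?e \<and> expectation ?e \<le> ?bound"
    proof (cases "R \<le> 1 / sqrt (real n)")
      case False
      then have R_large: "R > 1 / sqrt (real n)" by simp
      \<comment> \<open>The averaged gradient is given coefficient 0 to fit the common
        shape.\<close>
      have pointwise: "?e \<omega> \<le> lam / \<mu> * (R\<^sup>2 + lam * R\<^sup>2 / (2 * \<mu>)) + 1 / \<mu>\<^sup>2 * A i \<omega>
            + lam / \<mu> / (real m * \<mu>\<^sup>2) * (\<Sum>k=1..m. A k \<omega>) + 0 * B \<omega>" if \<omega>: "\<omega> \<in> space M" for \<omega>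
      proof -
        interpret coupled_system "\<lambda>i. grad (?f \<omega> i)" m \<mu> lam R wstar "wl \<omega>" "wg \<omega>" wb
          by (rule system[OF \<omega>])
        show ?thesis
          using local_err_weak_coupling[OF i] by (simp add: A_def err_def noise_def distrib_left)
      qed
      have "integrable M ?e \<and> expectation ?e \<le> lam / \<mu> * (R\<^sup>2 + lam * R\<^sup>2 / (2 * \<mu>))
          + 1 / \<mu>\<^sup>2 * (\<rho>\<^sup>2 / real n)
          + lam / \<mu> / (real m * \<mu>\<^sup>2) * (real (card {1..m}) * (\<rho>\<^sup>2 / real n)) + 0 * (\<rho>\<^sup>2 / real N)"
        by (intro conjI expectation_affine_bound[where f = ?e and A = A and B = B,
              OF wl_meas[OF i] _ A B _ _ _ i pointwise]) (use lam mu in auto)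
      moreover have "lam / \<mu> * (R\<^sup>2 + lam * R\<^sup>2 / (2 * \<mu>)) + 1 / \<mu>\<^sup>2 * (\<rho>\<^sup>2 / real n)
          + lam / \<mu> / (real m * \<mu>\<^sup>2) * (real (card {1..m}) * (\<rho>\<^sup>2 / real n)) + 0 * (\<rho>\<^sup>2 / real N)
          = 1 / \<mu>\<^sup>2 * (\<rho>\<^sup>2 / real n) + lam / \<mu> * (R\<^sup>2 + \<rho>\<^sup>2 / real n / \<mu>\<^sup>2 + lam * R\<^sup>2 / (2 * \<mu>))"
        using m0 by (simp add: distrib_left)
      moreover have "\<dots> \<le> C4 * min (R\<^sup>2) (1 / real n)"
        by (rule rate_weak_coupling[OF mu lam n0 R_large lam_large_R[OF R_large], of C2]) (simp_all add: C2 C4)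
      moreover have "C3 * (1 / real N) \<ge> 0" by (simp add: C3)
      ultimately show ?thesis by linarith
    next
      case True
      have R_min: "min (R\<^sup>2) (1 / real n) = R\<^sup>2"
      proof -
        have "R\<^sup>2 \<le> (1 / sqrt (real n))\<^sup>2" using True R by (intro power_mono) auto
        then show ?thesis using n0 by (simp add: power_divide)
      qed
      note lam_ge = lam_small_R[OF True, unfolded kappa]
      have strong: "64 * (L / \<mu>)\<^sup>2 * L \<le> lam + \<mu>"
        and La: "max (2 * (L / \<mu>)) 5 * \<mu> * ((2 * L\<^sup>2 * R\<^sup>2 + \<rho>\<^sup>2 / real n) / (L\<^sup>2 * R\<^sup>2 + \<rho>\<^sup>2 / real N)) \<le> lam + \<mu>"
        using lam_ge by linarith+
      have pointwise: "?e \<omega> \<le> (4 * R\<^sup>2 + 16 / \<mu>\<^sup>2 * (L\<^sup>2 * R\<^sup>2)) + 4 / (lam + \<mu>)\<^sup>2 * A i \<omega>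
            + 16 / \<mu>\<^sup>2 * (L / (lam + \<mu>))\<^sup>2 / real m * (\<Sum>k=1..m. A k \<omega>) + 16 / \<mu>\<^sup>2 * B \<omega>" if \<omega>: "\<omega> \<in> space M" for \<omega>
      proof -
        interpret strongly_coupled_system "\<lambda>i. grad (?f \<omega> i)" m \<mu> lam R wstar "wl \<omega>" "wg \<omega>" wb L
          by (intro strongly_coupled_system.intro system[OF \<omega>] strongly_coupled_system_axioms.intro
              grad_lip[OF _ \<omega>] mu_le_L strong)
        show ?thesis
          using local_err_strong_coupling[OF i] by (simp add: A_def B_def err_def noise_def distrib_left)
      qed
      have "integrable M ?e \<and> expectation ?e \<le> (4 * R\<^sup>2 + 16 / \<mu>\<^sup>2 * (L\<^sup>2 * R\<^sup>2))
          + 4 / (lam + \<mu>)\<^sup>2 * (\<rho>\<^sup>2 / real n)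
          + 16 / \<mu>\<^sup>2 * (L / (lam + \<mu>))\<^sup>2 / real m * (real (card {1..m}) * (\<rho>\<^sup>2 / real n))
          + 16 / \<mu>\<^sup>2 * (\<rho>\<^sup>2 / real N)"
        by (intro conjI expectation_affine_bound[where f = ?e and A = A and B = B,
              OF wl_meas[OF i] _ A B _ _ _ i pointwise]) (use lam mu in auto)
      moreover have "16 / \<mu>\<^sup>2 * (L / (lam + \<mu>))\<^sup>2 / real m * (real (card {1..m}) * (\<rho>\<^sup>2 / real n))
          = 16 / \<mu>\<^sup>2 * (L / (lam + \<mu>))\<^sup>2 * (\<rho>\<^sup>2 / real n)"
        using m0 by simp
      moreover have "4 * R\<^sup>2 + 16 / \<mu>\<^sup>2 * (L\<^sup>2 * R\<^sup>2) + 4 / (lam + \<mu>)\<^sup>2 * (\<rho>\<^sup>2 / real n)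
          + 16 / \<mu>\<^sup>2 * (L / (lam + \<mu>))\<^sup>2 * (\<rho>\<^sup>2 / real n) + 16 / \<mu>\<^sup>2 * (\<rho>\<^sup>2 / real N)
          \<le> 192 / \<mu>\<^sup>2 * (\<rho>\<^sup>2 / real N) + 198 * (L / \<mu>)\<^sup>2 * R\<^sup>2"
      proof (rule rate_strong_coupling[OF mu mu_le_L])
        \<comment> \<open>\<open>N = m * n\<close> with \<open>m\<close> positive makes the averaged
          noise bound the smaller one, and both vanish together exactly when \<rho> does.\<close>
        have rs: "\<rho>\<^sup>2 / real N \<le> \<rho>\<^sup>2 / real n" "\<rho>\<^sup>2 / real N = 0 \<Longrightarrow> \<rho>\<^sup>2 / real n = 0"
          using m n by (auto simp: N intro!: divide_left_mono)
        have L0: "L \<ge> 0" using mu mu_le_L by simp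
        show "25 * \<mu>\<^sup>2 * (\<rho>\<^sup>2 / real n) \<le> (L\<^sup>2 * R\<^sup>2 + \<rho>\<^sup>2 / real N) * (lam + \<mu>)\<^sup>2"
          "4 * L\<^sup>2 * (\<rho>\<^sup>2 / real n) \<le> (L\<^sup>2 * R\<^sup>2 + \<rho>\<^sup>2 / real N) * (lam + \<mu>)\<^sup>2"
          using coupling_dominates_variance[OF mu L0 _ rs La] by auto
      qed (use lam mu in auto)
      moreover have "192 / \<mu>\<^sup>2 * (\<rho>\<^sup>2 / real N) = C3 * (1 / real N)" by (simp add: C3)
      moreover have "198 * (L / \<mu>)\<^sup>2 * R\<^sup>2 \<le> C4 * R\<^sup>2"
        by (intro mult_right_mono) (simp_all add: C4 kappa)
      ultimately show ?thesis unfolding R_min by linarith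
    qed
  qed
qed

end
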